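(* Let $t\geq 4$ and let $G$ be a $K_{2,t}$-minor free graph of order $n\geq t^2+4t+1$. Then $$q(G)\leq \frac{n+2t-2+\sqrt{(n-2t+2)^2+8t-8}}{2},$$ with equality if and only if $n\equiv 1 \pmod t$ and $G=F_{2,t}(n)$.
   Context: All graphs are finite, simple and undirected. For a graph $G$, $Q(G)=D(G)+A(G)$ is the signless Laplacian matrix ($D(G)$ the diagonal degree matrix, $A(G)$ the adjacency matrix), and $q(G)$ denotes its largest eigenvalue. A graph $H$ is a minor of $G$ if $H$ can be obtained from $G$ by deleting edges, contracting edges, or deleting vertices; $G$ is $H$-minor free if it has no minor isomorphic to $H$. $K_{s,t}$ is the complete bipartite graph with parts of sizes $s$ and $t$, and $K_m$ the complete graph on $m$ vertices. $G\cup H$ is disjoint union, $G\vee H$ is the join (disjoint union plus all edges between the two vertex sets), and $k\cdot G$ is the disjoint union of $k$ copies of $G$. For $2\le s\le t$, write $n-s+1=pt+r$ with $0\le r<t$, and set $F_{s,t}(n):=K_{s-1}\vee(p\cdot K_t\cup K_r)$ (where $K_0$ is the empty graph). *)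

theory Defs
  imports Complex_Main
begin

type_synonym 'a graph = "'a set \<times> 'a set set"

definition verts :: "'a graph \<Rightarrow> 'a set" where "verts G = fst G"
definition edges :: "'a graph \<Rightarrow> 'a set set" where "edges G = snd G"

definition simple_graph :: "'a graph \<Rightarrow> bool" where
  "simple_graph G \<longleftrightarrow> finite (verts G) \<and> (\<forall>e\<in>edges G. e \<subseteq> verts G \<and> card e = 2)"

definition graph_iso :: "'a graph \<Rightarrow> 'b graph \<Rightarrow> bool" where
  "graph_iso G H \<longleftrightarrow> (\<exists>f. bij_betw f (verts G) (verts H) \<and> edges H = (\<lambda>e. f ` e) ` edges G)"

definition del_edge :: "'a graph \<Rightarrow> 'a set \<Rightarrow> 'a graph" where
  "del_edge G e = (verts G, edges G - {e})"

definition del_vertex :: "'a graph \<Rightarrow> 'a \<Rightarrow> 'a graph" where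
  "del_vertex G v = (verts G - {v}, {e \<in> edges G. v \<notin> e})"

definition contract_edge :: "'a graph \<Rightarrow> 'a \<Rightarrow> 'a \<Rightarrow> 'a graph" where
  "contract_edge G u v = (verts G - {v},
     {e \<in> edges G. v \<notin> e} \<union> {{u, w} | w. {v, w} \<in> edges G \<and> w \<noteq> u})"

inductive minor_step :: "'a graph \<Rightarrow> 'a graph \<Rightarrow> bool" where
  "e \<in> edges G \<Longrightarrow> minor_step G (del_edge G e)"
| "v \<in> verts G \<Longrightarrow> minor_step G (del_vertex G v)"
| "{u, v} \<in> edges G \<Longrightarrow> u \<noteq> v \<Longrightarrow> minor_step G (contract_edge G u v)"

definition is_minor :: "'b graph \<Rightarrow> 'a graph \<Rightarrow> bool" where
  "is_minor H G \<longleftrightarrow> (\<exists>G'. minor_step\<^sup>*\<^sup>* G G' \<and> graph_iso G' H)"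

definition minor_free :: "'a graph \<Rightarrow> 'b graph \<Rightarrow> bool" where
  "minor_free G H \<longleftrightarrow> \<not> is_minor H G"

definition Kbip :: "nat \<Rightarrow> nat \<Rightarrow> nat graph" where
  "Kbip s t = ({0..<s+t}, {{x, y} | x y. x < s \<and> s \<le> y \<and> y < s + t})"

text \<open>F_{s,t}(n) = K_{s-1} join (p K_t \<union> K_r) where n-s+1 = p t + r, 0 \<le> r < t.
  Vertices 0..n-1; vertices below s-1 form the K_{s-1}, the others are grouped
  into consecutive blocks of size t (the last block has size r).\<close>
definition F_graph :: "nat \<Rightarrow> nat \<Rightarrow> nat \<Rightarrow> nat graph" where
  "F_graph s t n = ({0..<n}, {{x, y} | x y. x < n \<and> y < n \<and> x \<noteq> y \<and>
      (x < s - 1 \<or> y < s - 1 \<or> (x - (s - 1)) div t = (y - (s - 1)) div t)})"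

definition degree :: "'a graph \<Rightarrow> 'a \<Rightarrow> nat" where
  "degree G v = card {u \<in> verts G. {u, v} \<in> edges G}"

definition signless_lap_mult :: "'a graph \<Rightarrow> ('a \<Rightarrow> real) \<Rightarrow> 'a \<Rightarrow> real" where
  "signless_lap_mult G x v =
     real (degree G v) * x v + (\<Sum>u\<in>{u \<in> verts G. {u, v} \<in> edges G}. x u)"

definition Q_eigenvalue :: "'a graph \<Rightarrow> real \<Rightarrow> bool" where
  "Q_eigenvalue G mu \<longleftrightarrow> (\<exists>x. (\<forall>v. v \<notin> verts G \<longrightarrow> x v = 0) \<and> (\<exists>v\<in>verts G. x v \<noteq> 0) \<and>
     (\<forall>v\<in>verts G. signless_lap_mult G x v = mu * x v))"

text \<open>q(G): the largest eigenvalue of Q(G) (Q(G) is real symmetric, so all its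
  eigenvalues are real).\<close>
definition q_index :: "'a graph \<Rightarrow> real" where
  "q_index G = Max {mu. Q_eigenvalue G mu}"

end

theory Submission
  imports Defs "Jordan_Normal_Form.Spectral_Radius"
begin

text \<open>Let \<open>b\<close> be the claimed bound; it exceeds \<open>n\<close>. An eigenvalue is at most the largest
  ratio \<open>(Q x) v / x v\<close> for any positive weights \<open>x\<close>. Two vertices have fewer than \<open>t\<close> common
  neighbours, and this alone gives \<open>q \<le> n\<close> if there is no dominating vertex: if all degrees are
  below \<open>n - t\<close>, take the degrees as weights; if some vertex has degree between \<open>n - t\<close> and
  \<open>n - 2\<close>, give it weight \<open>(n - 2) / 2\<close> and all others weight 1.

  If \<open>v\<close> is dominating, all other degrees are at most \<open>t\<close>, and the weights \<open>b - 2 t + 1\<close> at \<open>v\<close>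
  and 1 elsewhere give \<open>q \<le> b\<close>. Equality forces \<open>G - v\<close> to be \<open>(t - 1)\<close>-regular. Contracting an
  edge \<open>x y\<close> of \<open>G - v\<close> must not produce \<open>t\<close> common neighbours with \<open>v\<close>, so \<open>x\<close> and \<open>y\<close> have at
  least \<open>t - 3\<close> common neighbours in \<open>G - v\<close>, while nonadjacent vertices have at most \<open>t - 2\<close>. For
  \<open>t \<ge> 4\<close> this makes adjacent vertices have the same closed neighbourhood, so \<open>G - v\<close> is a
  disjoint union of copies of \<open>K\<^sub>t\<close>.\<close>

section \<open>Spectrum of a real symmetric kernel\<close>

text \<open>Matrices are indexed by the set \<open>V\<close> itself and the field is left open, so
  that one notion serves a real matrix and its complexification.\<close>

definition kernel_eigenvalue :: "'a set \<Rightarrow> ('a \<Rightarrow> 'a \<Rightarrow> 'b::field) \<Rightarrow> 'b \<Rightarrow> bool" where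
  "kernel_eigenvalue V a k \<longleftrightarrow>
     (\<exists>z. (\<exists>v\<in>V. z v \<noteq> 0) \<and> (\<forall>v\<in>V. (\<Sum>u\<in>V. a v u * z u) = k * z v))"

text \<open>An enumeration \<open>h\<close> of \<open>V\<close> carries eigenvectors back and forth,
  which opens the way to the spectral theory of concrete matrices.\<close>

lemma kernel_eigenvalue_matrix:
  fixes a :: "'a \<Rightarrow> 'a \<Rightarrow> 'b::field"
  assumes h: "bij_betw h {0..<n} V"
  shows "eigenvalue (mat n n (\<lambda>(i, j). a (h i) (h j))) k \<longleftrightarrow> kernel_eigenvalue V a k"
proof
  let ?A = "mat n n (\<lambda>(i, j). a (h i) (h j))"
  assume "eigenvalue ?A k"
  then obtain w where w: "w \<in> carrier_vec n" "w \<noteq> 0\<^sub>v n" "?A *\<^sub>v w = k \<cdot>\<^sub>v w"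
    unfolding eigenvalue_def eigenvector_def by auto
  define z where "z v = w $ (inv_into {0..<n} h v)" for v
  have zh: "z (h i) = w $ i" if "i < n" for i
    using h that unfolding z_def bij_betw_def by auto
  obtain i where "i < n" "w $ i \<noteq> 0"
    using w(1,2) by (metis carrier_vecD eq_vecI index_zero_vec)
  hence "\<exists>v\<in>V. z v \<noteq> 0"
    using zh h by (intro bexI[of _ "h i"]) (auto simp: bij_betw_def)
  moreover have "(\<Sum>u\<in>V. a v u * z u) = k * z v" if "v \<in> V" for v
  proof -
    obtain i where i: "i < n" "v = h i"
      using h \<open>v \<in> V\<close> by (auto simp: bij_betw_def)
    have "(\<Sum>u\<in>V. a v u * z u) = (\<Sum>j\<in>{0..<n}. a v (h j) * z (h j))"
      by (rule sum.reindex_bij_betw[OF h, symmetric])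
    also have "\<dots> = (\<Sum>j\<in>{0..<n}. a (h i) (h j) * w $ j)"
      by (intro sum.cong) (auto simp: zh i)
    also have "\<dots> = (?A *\<^sub>v w) $ i"
      using i w(1) by (auto simp: scalar_prod_def)
    also have "\<dots> = k * z v"
      using i w zh by auto
    finally show ?thesis .
  qed
  ultimately show "kernel_eigenvalue V a k"
    unfolding kernel_eigenvalue_def by blast
next
  let ?A = "mat n n (\<lambda>(i, j). a (h i) (h j))"
  assume "kernel_eigenvalue V a k"
  then obtain z where z: "\<exists>v\<in>V. z v \<noteq> 0" "\<And>v. v \<in> V \<Longrightarrow> (\<Sum>u\<in>V. a v u * z u) = k * z v"
    unfolding kernel_eigenvalue_def by blast
  define w where "w = vec n (\<lambda>i. z (h i))"
  obtain i where i: "i < n" "z (h i) \<noteq> 0"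
    using z(1) h by (auto simp: bij_betw_def)
  have "w \<noteq> 0\<^sub>v n"
  proof
    assume "w = 0\<^sub>v n"
    hence "w $ i = 0" using i by simp
    thus False using i by (simp add: w_def)
  qed
  moreover have "?A *\<^sub>v w = k \<cdot>\<^sub>v w"
  proof (rule eq_vecI)
    fix i assume "i < dim_vec (k \<cdot>\<^sub>v w)"
    hence i: "i < n" by (simp add: w_def)
    hence "h i \<in> V" using h by (auto simp: bij_betw_def)
    have "(?A *\<^sub>v w) $ i = (\<Sum>j\<in>{0..<n}. a (h i) (h j) * z (h j))"
      using i by (auto simp: w_def scalar_prod_def)
    also have "\<dots> = (\<Sum>u\<in>V. a (h i) u * z u)"
      by (rule sum.reindex_bij_betw[OF h])
    also have "\<dots> = (k \<cdot>\<^sub>v w) $ i"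
      using z(2)[OF \<open>h i \<in> V\<close>] i by (simp add: w_def)
    finally show "(?A *\<^sub>v w) $ i = (k \<cdot>\<^sub>v w) $ i" .
  qed (simp add: w_def)
  ultimately show "eigenvalue ?A k"
    unfolding eigenvalue_def eigenvector_def by (intro exI[of _ w]) (auto simp: w_def)
qed

lemma kernel_eigenvalue_of_real:
  fixes a :: "'a \<Rightarrow> 'a \<Rightarrow> real"
  assumes "kernel_eigenvalue V a \<mu>"
  shows "kernel_eigenvalue V (\<lambda>v u. complex_of_real (a v u)) (of_real \<mu>)"
proof -
  obtain z where z: "\<exists>v\<in>V. z v \<noteq> 0" "\<And>v. v \<in> V \<Longrightarrow> (\<Sum>u\<in>V. a v u * z u) = \<mu> * z v"
    using assms unfolding kernel_eigenvalue_def by blast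
  have "(\<Sum>u\<in>V. complex_of_real (a v u) * of_real (z u)) = of_real \<mu> * of_real (z v)"
    if "v \<in> V" for v
    using z(2)[OF that, THEN arg_cong, of complex_of_real] by simp
  thus ?thesis
    unfolding kernel_eigenvalue_def using z(1) by (intro exI[of _ "\<lambda>v. of_real (z v)"]) auto
qed

text \<open>For an eigenvector \<open>z\<close>, the form \<open>z* A z\<close> is its own conjugate
  by symmetry and equals \<open>k\<close> times the squared norm of \<open>z\<close>, so
  \<open>k\<close> is real. The real and imaginary parts of \<open>z\<close> then satisfy the same
  equation, and one of them is nonzero.\<close>

lemma kernel_eigenvalue_Re:
  fixes a :: "'a \<Rightarrow> 'a \<Rightarrow> real"
  assumes sym: "\<And>u v. a u v = a v u" and fin: "finite V"
    and ev: "kernel_eigenvalue V (\<lambda>v u. complex_of_real (a v u)) k"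
  shows "kernel_eigenvalue V a (Re k)"
proof -
  obtain z where z: "\<exists>v\<in>V. z v \<noteq> 0"
    "\<And>v. v \<in> V \<Longrightarrow> (\<Sum>u\<in>V. complex_of_real (a v u) * z u) = k * z v"
    using ev unfolding kernel_eigenvalue_def by blast
  define N where "N = (\<Sum>v\<in>V. (cmod (z v))\<^sup>2)"
  have "N > 0"
    unfolding N_def using z(1) fin by (auto intro!: sum_pos2)
  define S where "S = (\<Sum>v\<in>V. cnj (z v) * (\<Sum>u\<in>V. complex_of_real (a v u) * z u))"
  have "S = (\<Sum>v\<in>V. cnj (z v) * (k * z v))"
    unfolding S_def by (intro sum.cong) (auto simp: z(2))
  also have "\<dots> = k * of_real N"
    unfolding N_def of_real_sum sum_distrib_left
    by (intro sum.cong) (simp_all only: complex_norm_square mult_ac)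
  finally have 1: "S = k * of_real N" .
  \<comment> \<open>Exchanging the two summations turns the form into its conjugate, because the
    kernel is real and symmetric.\<close>
  have "S = (\<Sum>v\<in>V. \<Sum>u\<in>V. of_real (a v u) * cnj (z v) * z u)"
    unfolding S_def by (simp add: sum_distrib_left algebra_simps)
  also have "\<dots> = (\<Sum>u\<in>V. \<Sum>v\<in>V. of_real (a v u) * cnj (z v) * z u)"
    by (rule sum.swap)
  also have "\<dots> = cnj S"
    unfolding S_def by (simp add: sum_distrib_left algebra_simps) (simp add: sym)
  finally have "Im S = 0"
    by (metis Reals_cnj_iff complex_is_Real_iff)
  with 1 \<open>N > 0\<close> have "Im k = 0" by simp
  hence k: "k = of_real (Re k)" by (simp add: complex_eq_iff)
  have re: "(\<Sum>u\<in>V. a v u * Re (z u)) = Re k * Re (z v)"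
    and im: "(\<Sum>u\<in>V. a v u * Im (z u)) = Re k * Im (z v)" if "v \<in> V" for v
  proof -
    from z(2)[OF that] k have e: "(\<Sum>u\<in>V. complex_of_real (a v u) * z u) = of_real (Re k) * z v"
      by simp
    from arg_cong[OF e, of Re] arg_cong[OF e, of Im]
    show "(\<Sum>u\<in>V. a v u * Re (z u)) = Re k * Re (z v)"
      and "(\<Sum>u\<in>V. a v u * Im (z u)) = Re k * Im (z v)" by simp_all
  qed
  from z(1) obtain v where "v \<in> V" "z v \<noteq> 0" by blast
  hence "Re (z v) \<noteq> 0 \<or> Im (z v) \<noteq> 0" by (simp add: complex_eq_iff)
  thus ?thesis
  proof
    assume "Re (z v) \<noteq> 0"
    with re \<open>v \<in> V\<close> show ?thesis
      unfolding kernel_eigenvalue_def by (intro exI[of _ "\<lambda>v. Re (z v)"]) auto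
  next
    assume "Im (z v) \<noteq> 0"
    with im \<open>v \<in> V\<close> show ?thesis
      unfolding kernel_eigenvalue_def by (intro exI[of _ "\<lambda>v. Im (z v)"]) auto
  qed
qed

text \<open>Finiteness is inherited from the complex spectrum. Nonemptiness follows since a complex
  eigenvalue exists and its real part is an eigenvalue of the real kernel.\<close>

lemma kernel_spectrum:
  fixes a :: "'a \<Rightarrow> 'a \<Rightarrow> real"
  assumes sym: "\<And>u v. a u v = a v u" and fin: "finite V" and ne: "V \<noteq> {}"
  shows "finite {\<mu>. kernel_eigenvalue V a \<mu>}" and "{\<mu>. kernel_eigenvalue V a \<mu>} \<noteq> {}"
proof -
  let ?c = "\<lambda>v u. complex_of_real (a v u)"
  define n where "n = card V"
  obtain h where h: "bij_betw h {0..<n} V"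
    using ex_bij_betw_nat_finite[OF fin] n_def by blast
  define A where "A = mat n n (\<lambda>(i, j). ?c (h i) (h j))"
  have A: "A \<in> carrier_mat n n" by (simp add: A_def)
  have spec: "spectrum A = {k. kernel_eigenvalue V ?c k}"
    unfolding spectrum_def A_def using kernel_eigenvalue_matrix[OF h, of ?c] by blast
  have "of_real ` {\<mu>. kernel_eigenvalue V a \<mu>} \<subseteq> spectrum A"
    using spec kernel_eigenvalue_of_real by blast
  hence "finite (complex_of_real ` {\<mu>. kernel_eigenvalue V a \<mu>})"
    using card_finite_spectrum(1)[OF A] finite_subset by blast
  thus "finite {\<mu>. kernel_eigenvalue V a \<mu>}"
    by (rule finite_imageD) (simp add: inj_on_def)
  have "n > 0" using fin ne by (simp add: n_def card_gt_0_iff)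
  from spectrum_non_empty[OF A this] spec obtain k where "kernel_eigenvalue V ?c k" by blast
  from kernel_eigenvalue_Re[OF sym fin this]
  show "{\<mu>. kernel_eigenvalue V a \<mu>} \<noteq> {}" by blast
qed

section \<open>Signless Laplacian eigenvalues\<close>

definition nbrs :: "'a graph \<Rightarrow> 'a \<Rightarrow> 'a set" where
  "nbrs G v = {u \<in> verts G. {u, v} \<in> edges G}"

lemma degree_nbrs: "Defs.degree G v = card (nbrs G v)"
  by (simp add: Defs.degree_def nbrs_def)

lemma signless_lap_mult_nbrs:
  "signless_lap_mult G x v = real (card (nbrs G v)) * x v + (\<Sum>u\<in>nbrs G v. x u)"
  by (simp add: signless_lap_mult_def degree_nbrs) (simp add: nbrs_def)

lemma nbrs_subset: "nbrs G v \<subseteq> verts G"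
  by (auto simp: nbrs_def)

lemma finite_nbrs: "simple_graph G \<Longrightarrow> finite (nbrs G v)"
  by (metis finite_subset nbrs_subset simple_graph_def)

lemma nbrs_sym: "v \<in> verts G \<Longrightarrow> u \<in> nbrs G v \<Longrightarrow> v \<in> nbrs G u"
  by (auto simp: nbrs_def insert_commute)

lemma nbrs_irrefl: "simple_graph G \<Longrightarrow> v \<notin> nbrs G v"
  by (auto simp: nbrs_def simple_graph_def)

text \<open>\<open>q_index\<close> is a \<open>Max\<close>, which has its intended meaning only on a
  finite nonempty set.\<close>

lemma Q_eigenvalue_spectrum:
  assumes "simple_graph G" and "verts G \<noteq> {}"
  shows "finite {\<mu>. Q_eigenvalue G \<mu>}" and "{\<mu>. Q_eigenvalue G \<mu>} \<noteq> {}"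
proof -
  have fin: "finite (verts G)" using assms by (simp add: simple_graph_def)
  \<comment> \<open>The entries of \<open>D + A\<close>.\<close>
  define a where "a v u = (if u = v then real (card (nbrs G v)) else 0)
      + (if {u, v} \<in> edges G then 1 else 0)" for u v
  have sym: "a u v = a v u" for u v by (auto simp: a_def insert_commute)
  have lap: "(\<Sum>u\<in>verts G. a v u * x u) = signless_lap_mult G x v" if "v \<in> verts G" for v x
  proof -
    have "(\<Sum>u\<in>verts G. a v u * x u) = (\<Sum>u\<in>verts G. (if u = v then real (card (nbrs G v)) * x u else 0)
        + (if {u, v} \<in> edges G then x u else 0))"
      by (intro sum.cong) (auto simp: a_def distrib_right)
    also have "\<dots> = real (card (nbrs G v)) * x v + (\<Sum>u\<in>nbrs G v. x u)"
      using fin that by (simp add: sum.distrib nbrs_def sum.inter_filter)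
    finally show ?thesis by (simp add: signless_lap_mult_nbrs)
  qed
  have "Q_eigenvalue G \<mu> \<longleftrightarrow> kernel_eigenvalue (verts G) a \<mu>" for \<mu>
  proof
    assume "Q_eigenvalue G \<mu>"
    thus "kernel_eigenvalue (verts G) a \<mu>"
      unfolding Q_eigenvalue_def kernel_eigenvalue_def using lap by metis
  next
    assume "kernel_eigenvalue (verts G) a \<mu>"
    then obtain z where z: "\<exists>v\<in>verts G. z v \<noteq> 0"
      "\<And>v. v \<in> verts G \<Longrightarrow> (\<Sum>u\<in>verts G. a v u * z u) = \<mu> * z v"
      unfolding kernel_eigenvalue_def by blast
    \<comment> \<open>\<open>Q_eigenvalue\<close> asks for a vector that vanishes off the vertex
      set.\<close>
    define y where "y v = (if v \<in> verts G then z v else 0)" for v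
    have "signless_lap_mult G y v = \<mu> * y v" if "v \<in> verts G" for v
    proof -
      have "(\<Sum>u\<in>verts G. a v u * y u) = (\<Sum>u\<in>verts G. a v u * z u)"
        by (intro sum.cong) (auto simp: y_def)
      thus ?thesis using z(2)[OF that] lap[OF that, of y] that by (simp add: y_def)
    qed
    thus "Q_eigenvalue G \<mu>"
      unfolding Q_eigenvalue_def using z(1) by (intro exI[of _ y]) (auto simp: y_def)
  qed
  hence eq: "{\<mu>. Q_eigenvalue G \<mu>} = {\<mu>. kernel_eigenvalue (verts G) a \<mu>}" by blast
  show "finite {\<mu>. Q_eigenvalue G \<mu>}" "{\<mu>. Q_eigenvalue G \<mu>} \<noteq> {}"
    unfolding eq by (rule kernel_spectrum[OF sym fin assms(2)])+
qed

lemma Q_eigenvalue_q_index: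
  assumes "simple_graph G" and "verts G \<noteq> {}"
  shows "Q_eigenvalue G (q_index G)"
  using Max_in[OF Q_eigenvalue_spectrum[OF assms]] by (simp add: q_index_def)

lemma Q_eigenvalue_le_q_index:
  assumes "simple_graph G" and "Q_eigenvalue G \<mu>"
  shows "\<mu> \<le> q_index G"
proof -
  have "verts G \<noteq> {}" using assms(2) by (auto simp: Q_eigenvalue_def)
  thus ?thesis
    using Max_ge[OF Q_eigenvalue_spectrum(1)[OF assms(1)]] assms(2) by (simp add: q_index_def)
qed

section \<open>Comparison of eigenvectors with nonnegative weights\<close>

text \<open>The number \<open>m\<close> is the maximum of \<open>\<bar>y v\<bar> / x v\<close> over
  the vertices of positive weight; at the others \<open>y\<close> vanishes and the inequality is
  trivial.\<close>

lemma maximal_ratio: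
  fixes x y :: "'a \<Rightarrow> real"
  assumes fin: "finite V" and ne: "\<exists>v\<in>V. y v \<noteq> 0"
    and x0: "\<And>v. v \<in> V \<Longrightarrow> x v \<ge> 0" and xy: "\<And>v. v \<in> V \<Longrightarrow> x v = 0 \<Longrightarrow> y v = 0"
  obtains m v where "m > 0" "v \<in> V" "x v > 0" "\<bar>y v\<bar> = m * x v" "\<And>u. u \<in> V \<Longrightarrow> \<bar>y u\<bar> \<le> m * x u"
proof -
  define S where "S = {v \<in> V. x v > 0}"
  define m where "m = Max ((\<lambda>v. \<bar>y v\<bar> / x v) ` S)"
  obtain w where w: "w \<in> V" "y w \<noteq> 0" using ne by blast
  have "x w \<noteq> 0" using w xy by blast
  with x0[OF w(1)] have "x w > 0" by linarith
  with w(1) have "w \<in> S" by (simp add: S_def)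
  have finS: "finite S" using fin by (simp add: S_def)
  have "m \<in> (\<lambda>v. \<bar>y v\<bar> / x v) ` S"
    unfolding m_def using \<open>w \<in> S\<close> finS by (intro Max_in) auto
  then obtain v where v: "v \<in> S" "m = \<bar>y v\<bar> / x v" by blast
  have le: "\<bar>y u\<bar> / x u \<le> m" if "u \<in> S" for u
    unfolding m_def using finS that by (intro Max_ge) auto
  have "m > 0" using le[OF \<open>w \<in> S\<close>] w \<open>x w > 0\<close>
    by (meson divide_pos_pos less_le_trans zero_less_abs_iff)
  moreover have "\<bar>y u\<bar> \<le> m * x u" if "u \<in> V" for u
  proof (cases "x u = 0")
    case True
    thus ?thesis using xy[OF that] by simp
  next
    case False
    with x0[OF that] have "x u > 0" by linarith
    thus ?thesis using le[of u] that by (simp add: S_def pos_divide_le_eq)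
  qed
  moreover have "v \<in> V" "x v > 0" "\<bar>y v\<bar> = m * x v" using v by (auto simp: S_def)
  ultimately show thesis using that by blast
qed

text \<open>Collatz-Wielandt argument: take absolute values in the row of \<open>v\<close> and
  replace each \<open>\<bar>y u\<bar>\<close> by \<open>m * x u\<close>. If the resulting inequality
  is an equality, no replacement lost anything, so every neighbour of \<open>v\<close> attains the
  ratio \<open>m\<close> as well.\<close>

lemma eigenvalue_at_maximal_ratio:
  assumes G: "simple_graph G" and v: "v \<in> verts G" and ev: "signless_lap_mult G y v = \<mu> * y v"
    and m: "m > 0" and eq: "\<bar>y v\<bar> = m * x v"
    and le: "\<And>u. u \<in> verts G \<Longrightarrow> \<bar>y u\<bar> \<le> m * x u"
  shows "\<mu> * x v \<le> signless_lap_mult G x v"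
    and "\<mu> * x v = signless_lap_mult G x v \<Longrightarrow> u \<in> nbrs G v \<Longrightarrow> \<bar>y u\<bar> = m * x u"
proof -
  have le': "\<bar>y u\<bar> \<le> m * x u" if "u \<in> nbrs G v" for u
    using le that nbrs_subset by (metis subsetD)
  let ?d = "real (card (nbrs G v))"
  have "m * (\<mu> * x v) = \<mu> * \<bar>y v\<bar>" using eq by simp
  also have "\<dots> \<le> \<bar>\<mu> * y v\<bar>" by (simp add: abs_mult mult_right_mono)
  also have "\<dots> = \<bar>?d * y v + (\<Sum>u\<in>nbrs G v. y u)\<bar>"
    using ev by (simp add: signless_lap_mult_nbrs)
  also have "\<dots> \<le> \<bar>?d * y v\<bar> + \<bar>\<Sum>u\<in>nbrs G v. y u\<bar>" by (rule abs_triangle_ineq)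
  also have "\<dots> \<le> \<bar>?d * y v\<bar> + (\<Sum>u\<in>nbrs G v. \<bar>y u\<bar>)"
    by (intro add_left_mono sum_abs)
  finally have 1: "m * (\<mu> * x v) \<le> m * (?d * x v) + (\<Sum>u\<in>nbrs G v. \<bar>y u\<bar>)"
    using eq by (simp add: abs_mult algebra_simps)
  have 2: "(\<Sum>u\<in>nbrs G v. \<bar>y u\<bar>) \<le> (\<Sum>u\<in>nbrs G v. m * x u)"
    by (intro sum_mono le')
  have lap: "m * signless_lap_mult G x v = m * (?d * x v) + (\<Sum>u\<in>nbrs G v. m * x u)"
    by (simp add: signless_lap_mult_nbrs distrib_left sum_distrib_left)
  from 1 2 lap have "m * (\<mu> * x v) \<le> m * signless_lap_mult G x v" by linarith
  thus "\<mu> * x v \<le> signless_lap_mult G x v" using m by simp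
  assume e: "\<mu> * x v = signless_lap_mult G x v" and u: "u \<in> nbrs G v"
  from 1 lap e have "(\<Sum>u\<in>nbrs G v. m * x u) \<le> (\<Sum>u\<in>nbrs G v. \<bar>y u\<bar>)" by simp
  with 2 have "(\<Sum>u\<in>nbrs G v. \<bar>y u\<bar>) = (\<Sum>u\<in>nbrs G v. m * x u)" by linarith
  thus "\<bar>y u\<bar> = m * x u"
    by (rule sum_mono_inv) (use le' u finite_nbrs[OF G] in auto)
qed

text \<open>The weights may vanish, as the degree does at isolated vertices.\<close>

lemma Q_eigenvalue_weight_bound:
  assumes G: "simple_graph G" and ev: "Q_eigenvalue G \<mu>"
    and x0: "\<And>v. v \<in> verts G \<Longrightarrow> x v \<ge> 0"
    and iso: "\<And>v. v \<in> verts G \<Longrightarrow> x v = 0 \<Longrightarrow> nbrs G v = {}"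
    and c: "c \<ge> 0" and bound: "\<And>v. v \<in> verts G \<Longrightarrow> x v > 0 \<Longrightarrow> signless_lap_mult G x v \<le> c * x v"
  shows "\<mu> \<le> c"
proof (cases "\<mu> \<le> 0")
  case False
  obtain y where y: "\<exists>v\<in>verts G. y v \<noteq> 0"
    "\<And>v. v \<in> verts G \<Longrightarrow> signless_lap_mult G y v = \<mu> * y v"
    using ev unfolding Q_eigenvalue_def by blast
  \<comment> \<open>A vertex of weight 0 is isolated, so its row reads
    \<open>0 = \<mu> * y v\<close> with \<open>\<mu> > 0\<close>.\<close>
  have xy: "y v = 0" if "v \<in> verts G" "x v = 0" for v
    using y(2)[OF that(1)] iso[OF that] False by (simp add: signless_lap_mult_nbrs)
  have fin: "finite (verts G)" using G by (simp add: simple_graph_def)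
  obtain m v where m: "m > 0" and v: "v \<in> verts G" "x v > 0" "\<bar>y v\<bar> = m * x v"
    and le: "\<And>u. u \<in> verts G \<Longrightarrow> \<bar>y u\<bar> \<le> m * x u"
    using maximal_ratio[of "verts G" y x, OF fin y(1) x0 xy] by blast
  have "\<mu> * x v \<le> c * x v"
    using eigenvalue_at_maximal_ratio(1)[OF G v(1) y(2)[OF v(1)] m v(3) le] bound[OF v(1,2)]
    by linarith
  thus ?thesis using v(2) by simp
qed (use c in linarith)

section \<open>Forbidden local configurations\<close>

lemma minor_steps_del_edges:
  assumes "finite E" and "E \<subseteq> edges G"
  shows "minor_step\<^sup>*\<^sup>* G (verts G, edges G - E)"
  using assms
proof (induction E rule: finite_induct)
  case empty
  thus ?case by (simp add: verts_def edges_def)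
next
  case (insert e E)
  have "minor_step (verts G, edges G - E) (del_edge (verts G, edges G - E) e)"
    using insert by (intro minor_step.intros(1)) (auto simp: edges_def)
  moreover have "del_edge (verts G, edges G - E) e = (verts G, edges G - insert e E)"
    by (auto simp: del_edge_def verts_def edges_def)
  ultimately show ?case
    using insert by (metis insert_subset rtranclp.rtrancl_into_rtrancl)
qed

lemma minor_steps_del_verts:
  assumes "finite U" and "U \<subseteq> verts G"
  shows "minor_step\<^sup>*\<^sup>* G (verts G - U, {e \<in> edges G. e \<inter> U = {}})"
  using assms
proof (induction U rule: finite_induct)
  case empty
  thus ?case by (simp add: verts_def edges_def)
next
  case (insert u U)
  let ?H = "(verts G - U, {e \<in> edges G. e \<inter> U = {}})"
  have "minor_step ?H (del_vertex ?H u)"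
    using insert by (intro minor_step.intros(2)) (auto simp: verts_def)
  moreover have "del_vertex ?H u = (verts G - insert u U, {e \<in> edges G. e \<inter> insert u U = {}})"
    by (auto simp: del_vertex_def verts_def edges_def)
  ultimately show ?case
    using insert by (metis (no_types, lifting) insert_subset rtranclp.rtrancl_into_rtrancl)
qed

text \<open>First the vertices outside \<open>H\<close> are deleted, then the surviving edges that
  are not in \<open>H\<close>; both sets are finite, so single steps suffice.\<close>

lemma subgraph_minor_steps:
  assumes G: "simple_graph G" and V: "verts H \<subseteq> verts G" and E: "edges H \<subseteq> edges G"
    and H: "\<And>e. e \<in> edges H \<Longrightarrow> e \<subseteq> verts H"
  shows "minor_step\<^sup>*\<^sup>* G H"
proof -
  let ?U = "verts G - verts H"
  let ?G1 = "(verts G - ?U, {e \<in> edges G. e \<inter> ?U = {}})"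
  have fin: "finite (verts G)" using G by (simp add: simple_graph_def)
  have "edges G \<subseteq> Pow (verts G)" using G by (auto simp: simple_graph_def)
  hence finE: "finite (edges G)" using fin finite_subset by blast
  have 1: "minor_step\<^sup>*\<^sup>* G ?G1"
    by (rule minor_steps_del_verts) (use fin in auto)
  have 2: "minor_step\<^sup>*\<^sup>* ?G1 (verts ?G1, edges ?G1 - (edges ?G1 - edges H))"
    by (rule minor_steps_del_edges) (use finE in \<open>auto simp: edges_def\<close>)
  have "verts ?G1 = verts H" using V by (auto simp: verts_def)
  moreover have "edges H \<subseteq> edges ?G1"
    using E H by (auto simp: edges_def)
  hence "edges ?G1 - (edges ?G1 - edges H) = edges H" by blast
  ultimately have "(verts ?G1, edges ?G1 - (edges ?G1 - edges H)) = H"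
    by (simp add: verts_def edges_def)
  with 1 2 show ?thesis by simp
qed

text \<open>The vertices \<open>u\<close> and \<open>w\<close> with \<open>t\<close> of their common
  neighbours span a subgraph containing \<open>K_{2,t}\<close>; no contraction is involved.\<close>

lemma Kbip_2_minor:
  assumes G: "simple_graph G" and uw: "u \<in> verts G" "w \<in> verts G" "u \<noteq> w"
    and card: "t \<le> card (nbrs G u \<inter> nbrs G w)"
  shows "is_minor (Kbip 2 t) G"
proof -
  obtain T where T: "T \<subseteq> nbrs G u \<inter> nbrs G w" "card T = t" "finite T"
    using card by (metis obtain_subset_with_card_n)
  have uT: "u \<notin> T" "w \<notin> T" using T(1) nbrs_irrefl[OF G] by blast+
  define H where "H = ({u, w} \<union> T, {{a, c} | a c. a \<in> {u, w} \<and> c \<in> T})"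
  have "minor_step\<^sup>*\<^sup>* G H"
  proof (rule subgraph_minor_steps[OF G])
    show "verts H \<subseteq> verts G" using T(1) uw nbrs_subset by (fastforce simp: H_def verts_def)
    show "edges H \<subseteq> edges G"
      using T(1) by (auto simp: H_def edges_def nbrs_def insert_commute)
    show "e \<subseteq> verts H" if "e \<in> edges H" for e
      using that by (auto simp: H_def verts_def edges_def)
  qed
  moreover have "graph_iso H (Kbip 2 t)"
  proof -
    obtain h where h: "bij_betw h T {0..<t}"
      using ex_bij_betw_finite_nat[OF T(3)] T(2) by blast
    \<comment> \<open>In \<open>Kbip 2 t\<close> the part of size two is \<open>{0, 1}\<close> and
      the other part starts at 2.\<close>
    define f where "f x = (if x = u then 0 else if x = w then 1 else 2 + h x)" for x
    have fT: "f c = 2 + h c" if "c \<in> T" for c using that uT by (auto simp: f_def)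
    have fuw: "f u = 0" "f w = 1" using uw by (auto simp: f_def)
    have hT: "h ` T = {0..<t}" using h by (simp add: bij_betw_def)
    have imT: "f ` T = {2..<2 + t}"
    proof -
      have "f ` T = (\<lambda>k. k + 2) ` h ` T" using fT by (force simp: image_iff)
      also have "\<dots> = {0 + 2..<t + 2}" unfolding hT by (rule image_add_atLeastLessThan')
      finally show ?thesis by (simp only: add_0 add.commute)
    qed
    have "bij_betw f ({u, w} \<union> T) {0..<2 + t}"
    proof (rule bij_betw_imageI)
      show "f ` ({u, w} \<union> T) = {0..<2 + t}"
        unfolding image_Un imT using fuw by auto
      show "inj_on f ({u, w} \<union> T)"
        using h fT fuw by (auto simp: inj_on_def bij_betw_def)
    qed
    moreover have "{{x, y} | x y. x < 2 \<and> 2 \<le> y \<and> y < 2 + t}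
        = (\<lambda>e. f ` e) ` {{a, c} | a c. a \<in> {u, w} \<and> c \<in> T}" (is "?L = ?R")
    proof (intro Set.set_eqI iffI)
      fix e assume "e \<in> ?L"
      then obtain x y where e: "e = {x, y}" "x < 2" "y \<in> {2..<2 + t}" by auto
      obtain c where c: "c \<in> T" "y = f c" using e(3) imT by blast
      have "x = 0 \<or> x = 1" using e(2) by auto
      then obtain a where a: "a \<in> {u, w}" "x = f a" using fuw by fastforce
      have "e = f ` {a, c}" using e a c by simp
      with a c show "e \<in> ?R" by blast
    next
      fix e assume "e \<in> ?R"
      then obtain a c where e: "a \<in> {u, w}" "c \<in> T" "e = {f a, f c}" by auto
      have "f a < 2" using e(1) fuw by auto
      moreover have "2 \<le> f c" "f c < 2 + t" using e(2) imT by auto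
      ultimately show "e \<in> ?L" using e(3) by blast
    qed
    ultimately show ?thesis
      unfolding graph_iso_def H_def Kbip_def verts_def edges_def by auto
  qed
  ultimately show ?thesis unfolding is_minor_def by blast
qed

lemma common_nbrs_less:
  assumes "simple_graph G" "minor_free G (Kbip 2 t)" "u \<in> verts G" "w \<in> verts G" "u \<noteq> w"
  shows "card (nbrs G u \<inter> nbrs G w) < t"
proof (rule ccontr)
  assume "\<not> card (nbrs G u \<inter> nbrs G w) < t"
  hence "t \<le> card (nbrs G u \<inter> nbrs G w)" by simp
  from Kbip_2_minor[OF assms(1,3-5) this] assms(2) show False by (simp add: minor_free_def)
qed

lemma minor_free_minor_step:
  assumes "minor_free G K" and step: "minor_step G G'"
  shows "minor_free G' K"
  unfolding minor_free_def
proof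
  assume "is_minor K G'"
  then obtain H where "minor_step\<^sup>*\<^sup>* G' H" "graph_iso H K" unfolding is_minor_def by blast
  hence "is_minor K G"
    unfolding is_minor_def using converse_rtranclp_into_rtranclp[of minor_step, OF step] by blast
  with assms(1) show False by (simp add: minor_free_def)
qed

text \<open>Contracting the edge \<open>a c\<close> to \<open>a\<close> makes every neighbour of
  \<open>a\<close> or \<open>c\<close> a neighbour of \<open>a\<close>. The contracted graph is
  still minor free, so \<open>a\<close> and \<open>v\<close> have fewer than \<open>t\<close> common
  neighbours in it.\<close>

lemma nbrs_of_edge_common_less:
  assumes G: "simple_graph G" and free: "minor_free G (Kbip 2 t)"
    and a: "a \<in> verts G" and c: "c \<in> nbrs G a" and v: "v \<in> verts G" "v \<noteq> a" "v \<noteq> c"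
  shows "card ((nbrs G a \<union> nbrs G c) \<inter> nbrs G v - {a, c}) < t"
proof -
  have ac: "a \<noteq> c" using c nbrs_irrefl[OF G] by blast
  have edge: "{a, c} \<in> edges G" using c by (simp add: nbrs_def insert_commute)
  define G' where "G' = contract_edge G a c"
  have free': "minor_free G' (Kbip 2 t)"
    unfolding G'_def by (rule minor_free_minor_step[OF free minor_step.intros(3)[OF edge ac]])
  have V': "verts G' = verts G - {c}" by (simp add: G'_def contract_edge_def verts_def)
  have E': "edges G' = {e \<in> edges G. c \<notin> e} \<union> {{a, w} | w. {c, w} \<in> edges G \<and> w \<noteq> a}"
    by (simp add: G'_def contract_edge_def edges_def)
  have G': "simple_graph G'"
  proof -
    have "e \<subseteq> verts G' \<and> card e = 2" if e: "e \<in> edges G'" for e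
    proof -
      consider "e \<in> edges G" "c \<notin> e" | w where "e = {a, w}" "{c, w} \<in> edges G" "w \<noteq> a"
        using e E' by auto
      thus ?thesis
      proof cases
        case 1
        thus ?thesis using G V' by (auto simp: simple_graph_def)
      next
        case 2
        hence "w \<in> verts G" "card {c, w} = 2" using G by (auto simp: simple_graph_def)
        hence "w \<noteq> c" by auto
        thus ?thesis using 2 \<open>w \<in> verts G\<close> a ac V' by auto
      qed
    qed
    thus ?thesis using G V' by (simp add: simple_graph_def)
  qed
  have "(nbrs G a \<union> nbrs G c) \<inter> nbrs G v - {a, c} \<subseteq> nbrs G' a \<inter> nbrs G' v"
    using v ac a by (auto simp: nbrs_def V' E' insert_commute)
  moreover have "card (nbrs G' a \<inter> nbrs G' v) < t"
    using common_nbrs_less[OF G' free'] v a ac V' by simp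
  ultimately show ?thesis
    using finite_nbrs[OF G'] by (meson card_mono finite_Int le_less_trans)
qed

section \<open>Adjacent vertices with equal closed neighbourhoods\<close>

text \<open>Here \<open>N\<close> stands for adjacency in \<open>G - v\<close>. If the closed
  neighbourhoods of \<open>x\<close> and \<open>y\<close> differ, then \<open>x\<close> and
  \<open>y\<close> have exactly \<open>t - 3\<close> common neighbours, forming \<open>W\<close>,
  and one private neighbour each, \<open>a\<close> and \<open>b\<close>. The local bounds force
  \<open>b\<close> to be adjacent to all of \<open>N x\<close>, although \<open>b\<close> and
  \<open>x\<close> are nonadjacent.\<close>

lemma closed_nbhds_equal:
  fixes N :: "'a \<Rightarrow> 'a set"
  assumes t: "t \<ge> 4" and sub: "\<And>x. x \<in> V \<Longrightarrow> N x \<subseteq> V"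
    and sym: "\<And>x y. x \<in> V \<Longrightarrow> y \<in> N x \<Longrightarrow> x \<in> N y" and irr: "\<And>x. x \<in> V \<Longrightarrow> x \<notin> N x"
    and fin: "\<And>x. x \<in> V \<Longrightarrow> finite (N x)" and reg: "\<And>x. x \<in> V \<Longrightarrow> card (N x) = t - 1"
    and adj: "\<And>x y. x \<in> V \<Longrightarrow> y \<in> N x \<Longrightarrow> card (N x \<union> N y - {x, y}) < t"
    and nonadj: "\<And>x y. x \<in> V \<Longrightarrow> y \<in> V \<Longrightarrow> x \<noteq> y \<Longrightarrow> y \<notin> N x \<Longrightarrow> card (N x \<inter> N y) < t - 1"
    and xy: "x \<in> V" "y \<in> N x"
  shows "insert x (N x) = insert y (N y)"
proof (rule ccontr)
  assume neq: "insert x (N x) \<noteq> insert y (N y)"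
  \<comment> \<open>Both sets without the other endpoint have \<open>t - 2\<close> elements and
    their union has at most \<open>t - 1\<close>, which leaves at least
    \<open>2 (t - 2) - (t - 1) = t - 3\<close> in the intersection.\<close>
  have common: "t - 3 \<le> card (N x \<inter> N y)" if "x \<in> V" "y \<in> N x" for x y
  proof -
    have y: "y \<in> V" "x \<in> N y" using that sub sym by blast+
    have "card (N x - {y}) = t - 2" "card (N y - {x}) = t - 2"
      using that y reg fin by auto
    moreover have "(N x - {y}) \<union> (N y - {x}) = N x \<union> N y - {x, y}"
      "(N x - {y}) \<inter> (N y - {x}) = N x \<inter> N y"
      using irr that y by auto
    moreover have "card (N x - {y}) + card (N y - {x})
        = card ((N x - {y}) \<union> (N y - {x})) + card ((N x - {y}) \<inter> (N y - {x}))"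
      using fin that y by (intro card_Un_Int) auto
    ultimately show ?thesis using adj[OF that] t by simp
  qed
  define W where "W = N x \<inter> N y"
  have y: "y \<in> V" "x \<in> N y" using xy sub sym by blast+
  have finW: "finite W" using fin xy by (simp add: W_def)
  have cx: "card (N x - {y}) = t - 2" and cy: "card (N y - {x}) = t - 2"
    using xy y reg fin by auto
  have Wx: "W \<subseteq> N x - {y}" and Wy: "W \<subseteq> N y - {x}" using irr xy y by (auto simp: W_def)
  have "card W \<noteq> t - 2"
  proof
    assume "card W = t - 2"
    hence "W = N x - {y}" "W = N y - {x}"
      using Wx Wy cx cy fin xy y by (simp_all add: card_subset_eq)
    with neq xy y show False by blast
  qed
  moreover have "card W \<le> t - 2" using card_mono[OF _ Wx] cx fin xy by simp
  moreover have "t - 3 \<le> card W" using common[OF xy] by (simp add: W_def)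
  ultimately have cW: "card W = t - 3" using t by linarith
  have "card (N x - {y} - W) = 1" "card (N y - {x} - W) = 1"
    using card_Diff_subset[OF finW Wx] card_Diff_subset[OF finW Wy] cx cy cW t by auto
  then obtain a b where a: "N x - {y} - W = {a}" and b: "N y - {x} - W = {b}"
    by (metis card_1_singletonE)
  have Nx: "N x = {y, a} \<union> W" and Ny: "N y = {x, b} \<union> W"
    using a b Wx Wy xy y by blast+
  have aNx: "a \<in> N x" "a \<notin> N y" "a \<noteq> y" and bNy: "b \<in> N y" "b \<notin> N x" "b \<noteq> x"
    using a b by (auto simp: W_def)
  have aV: "a \<in> V" and bV: "b \<in> V" using aNx bNy sub xy y by blast+
  \<comment> \<open>Neither \<open>y\<close> nor \<open>a\<close> itself is adjacent to
    \<open>a\<close>, so the \<open>t - 3\<close> common neighbours of \<open>x\<close> and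
    \<open>a\<close> must fill \<open>W\<close>.\<close>
  have "N x \<inter> N a \<subseteq> W"
    using Nx aNx irr[OF aV] sym[OF aV] by auto
  moreover have "t - 3 \<le> card (N x \<inter> N a)" using common xy aNx by blast
  ultimately have "N x \<inter> N a = W"
    using cW finW by (simp add: card_seteq)
  hence Wa: "W \<subseteq> N a" by blast
  have "N y \<inter> N b \<subseteq> W"
    using Ny bNy irr[OF bV] sym[OF bV] by auto
  moreover have "t - 3 \<le> card (N y \<inter> N b)" using common y bNy by blast
  ultimately have "N y \<inter> N b = W"
    using cW finW by (simp add: card_seteq)
  hence Wb: "W \<subseteq> N b" by blast
  \<comment> \<open>Here \<open>t \<ge> 4\<close> is used: \<open>W\<close> has
    \<open>t - 3 \<ge> 1\<close> elements.\<close>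
  have "W \<noteq> {}" using cW t by auto
  then obtain w where w: "w \<in> W" by blast
  hence wV: "w \<in> V" using Wx sub xy by blast
  have wa: "w \<in> N a" "w \<in> N b" "w \<in> N y" using w Wa Wb Wy by blast+
  hence Nw: "a \<in> N w" "b \<in> N w" "y \<in> N w" using sym aV bV y by blast+
  have ab: "b \<in> N a"
  proof (rule ccontr)
    assume "b \<notin> N a"
    have "y \<notin> N a" using aNx sym aV by blast
    have "a \<noteq> b" "b \<noteq> y" using aNx bNy irr y by auto
    \<comment> \<open>Three of the \<open>t - 1\<close> neighbours of \<open>w\<close> are lost, one
      too many for the edge \<open>w a\<close>.\<close>
    have "N w \<inter> N a \<subseteq> N w - {y, a, b}"
      using \<open>b \<notin> N a\<close> \<open>y \<notin> N a\<close> irr[OF aV] by blast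
    hence "card (N w \<inter> N a) \<le> card (N w - {y, a, b})"
      using fin[OF wV] by (intro card_mono) auto
    also have "\<dots> = card (N w) - card {y, a, b}"
      using Nw by (intro card_Diff_subset) auto
    also have "card {y, a, b} = 3" using \<open>a \<noteq> b\<close> \<open>b \<noteq> y\<close> aNx by auto
    finally show False
      using common[OF wV Nw(1)] reg[OF wV] t by linarith
  qed
  \<comment> \<open>Now \<open>y\<close>, \<open>a\<close> and all of \<open>W\<close> are adjacent
    to \<open>b\<close>, so \<open>x\<close> and \<open>b\<close> have \<open>t - 1\<close> common
    neighbours.\<close>
  have "N x \<subseteq> N b" unfolding Nx using Wb sym[OF aV ab] sym[OF y(1) bNy(1)] by simp
  hence "card (N x \<inter> N b) = t - 1" using reg[OF xy(1)] by (simp add: inf_absorb1)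
  with nonadj[OF xy(1) bV] bNy show False by simp
qed

section \<open>The extremal graphs\<close>

lemma edge_doubleton:
  assumes "simple_graph G" "e \<in> edges G"
  obtains x y where "e = {x, y}" "x \<noteq> y" "x \<in> verts G" "y \<in> verts G"
proof -
  have "card e = 2" "e \<subseteq> verts G" using assms by (auto simp: simple_graph_def)
  then obtain x y where "e = {x, y}" "x \<noteq> y" by (meson card_2_iff)
  thus thesis using that[of x y] \<open>e \<subseteq> verts G\<close> by simp
qed

text \<open>The closed neighbourhoods in \<open>G - v\<close> partition it into cliques of size
  \<open>t\<close>. Numbering the cliques, and the vertices inside each clique, produces the
  consecutive blocks of \<open>F_graph\<close>.\<close>

lemma graph_iso_F_graph:
  assumes G: "simple_graph G" and n: "card (verts G) = n" and v: "v \<in> verts G"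
    and dom: "nbrs G v = verts G - {v}" and t: "t \<ge> 2"
    and reg: "\<And>x. x \<in> verts G - {v} \<Longrightarrow> card (nbrs G x - {v}) = t - 1"
    and cl: "\<And>x y. x \<in> verts G - {v} \<Longrightarrow> y \<in> nbrs G x - {v} \<Longrightarrow>
               insert x (nbrs G x - {v}) = insert y (nbrs G y - {v})"
  shows "n mod t = 1" and "graph_iso G (F_graph 2 t n)"
proof -
  define V where "V = verts G - {v}"
  define C where "C x = insert x (nbrs G x - {v})" for x
  define P where "P = C ` V"
  have finG: "finite (verts G)" using G by (simp add: simple_graph_def)
  hence finV: "finite V" by (simp add: V_def)
  have CV: "C x \<subseteq> V" if "x \<in> V" for x
    using that nbrs_subset[of G x] by (auto simp: C_def V_def)
  have cardC: "card (C x) = t" if "x \<in> V" for x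
    using reg[of x] that finite_nbrs[OF G, of x] nbrs_irrefl[OF G, of x] t
    by (simp add: C_def V_def)
  have Ceq: "C x = C y" if "x \<in> V" "y \<in> C x" for x y
    using that cl[of x y] by (auto simp: C_def V_def)
  have Cself: "x \<in> C x" for x by (simp add: C_def)
  have finP: "finite P" using finV by (simp add: P_def)
  have UP: "\<Union> P = V" using CV Cself by (auto simp: P_def)
  have "t * card P = card (\<Union> P)"
  proof (rule card_partition)
    show "finite (\<Union> P)" using UP finV by simp
    show "card c = t" if "c \<in> P" for c using that cardC by (auto simp: P_def)
    show "c \<inter> d = {}" if cd: "c \<in> P" "d \<in> P" "c \<noteq> d" for c d
    proof (rule ccontr)
      assume "c \<inter> d \<noteq> {}"
      then obtain z where "z \<in> c" "z \<in> d" by blast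
      with cd Ceq show False by (metis P_def imageE)
    qed
  qed (rule finP)
  hence nV: "t * card P = n - 1" "n \<ge> 1"
    using UP n v finG by (auto simp: V_def Suc_le_eq card_gt_0_iff)
  hence n': "n = 1 + t * card P" by simp
  show "n mod t = 1" using n' t by (simp add: mod_Suc)
  obtain g where g: "bij_betw g P {0..<card P}"
    using ex_bij_betw_finite_nat[OF finP] by blast
  have "\<exists>h. bij_betw h c {0..<t}" if "c \<in> P" for c
  proof -
    have "finite c" "card c = t" using that cardC CV finV by (auto simp: P_def intro: finite_subset)
    thus ?thesis using ex_bij_betw_finite_nat by blast
  qed
  then obtain h where h: "\<And>c. c \<in> P \<Longrightarrow> bij_betw (h c) c {0..<t}" by metis
  \<comment> \<open>The dominating vertex gets 0 and the blocks start at 1, so quotient and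
    remainder of \<open>f x - 1\<close> by \<open>t\<close> recover the clique of \<open>x\<close>
    and the position in it.\<close>
  define f where "f x = (if x = v then 0 else 1 + (t * g (C x) + h (C x) x))" for x
  have CP: "C x \<in> P" if "x \<in> V" for x using that by (simp add: P_def)
  have hx: "h (C x) x < t" if "x \<in> V" for x
    using h[OF CP[OF that]] Cself by (fastforce simp: bij_betw_def)
  have gx: "g (C x) < card P" if "x \<in> V" for x
    using g CP[OF that] by (fastforce simp: bij_betw_def)
  have fpos: "f x \<noteq> 0" if "x \<in> V" for x using that by (simp add: f_def V_def)
  have fdiv: "(f x - 1) div t = g (C x)" and fmod: "(f x - 1) mod t = h (C x) x" if "x \<in> V" for x
    using hx[OF that] that by (simp_all add: f_def V_def)
  have fv: "f v = 0" by (simp add: f_def)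
  have Cinj: "C x = C y" if "x \<in> V" "y \<in> V" "g (C x) = g (C y)" for x y
    using g CP that by (meson bij_betw_def inj_onD)
  have inj: "inj_on f (verts G)"
  proof (rule inj_onI)
    fix x y assume xy: "x \<in> verts G" "y \<in> verts G" "f x = f y"
    show "x = y"
    proof (cases "x = v \<or> y = v")
      case True
      thus ?thesis using xy fv fpos by (metis V_def insert_Diff insert_iff v)
    next
      case False
      hence V: "x \<in> V" "y \<in> V" using xy by (auto simp: V_def)
      have "C x = C y" using Cinj[OF V] fdiv[OF V(1)] fdiv[OF V(2)] xy(3) by simp
      moreover have "h (C x) x = h (C y) y" using fmod[OF V(1)] fmod[OF V(2)] xy(3) by simp
      ultimately show ?thesis
        using h[OF CP[OF V(1)]] Cself by (metis bij_betw_def inj_onD)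
    qed
  qed
  have range: "f ` verts G \<subseteq> {0..<n}"
  proof
    fix k assume "k \<in> f ` verts G"
    then obtain x where x: "x \<in> verts G" "k = f x" by blast
    show "k \<in> {0..<n}"
    proof (cases "x = v")
      case True
      thus ?thesis using x fv nV by simp
    next
      case False
      hence V: "x \<in> V" using x by (simp add: V_def)
      have "t * g (C x) + h (C x) x < t * g (C x) + t" using hx[OF V] by simp
      also have "\<dots> = t * Suc (g (C x))" by simp
      also have "\<dots> \<le> t * card P" using gx[OF V] by (intro mult_le_mono2) simp
      finally show ?thesis using x False n' by (simp add: f_def)
    qed
  qed
  have bij: "bij_betw f (verts G) {0..<n}"
    using inj range n finG by (metis bij_betw_def card_atLeastLessThan card_image card_subset_eq
        diff_zero finite_atLeastLessThan)
  \<comment> \<open>The unevaluated \<open>2 - 1\<close> matches \<open>F_graph_def\<close> at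
    \<open>s = 2\<close>.\<close>
  let ?adj = "\<lambda>a b. a \<noteq> b \<and> (a < 2 - 1 \<or> b < 2 - 1 \<or> (a - (2 - 1)) div t = (b - (2 - 1)) div t)"
  have adj: "{x, y} \<in> edges G \<longleftrightarrow> ?adj (f x) (f y)" if xy: "x \<in> verts G" "y \<in> verts G" for x y
  proof -
    have e: "{x, y} \<in> edges G \<longleftrightarrow> x \<in> nbrs G y" "{x, y} \<in> edges G \<longleftrightarrow> y \<in> nbrs G x"
      using xy by (auto simp: nbrs_def insert_commute)
    have ne: "f x \<noteq> f y \<longleftrightarrow> x \<noteq> y" using inj xy by (meson inj_onD)
    consider "x = v" | "y = v" | "x \<in> V" "y \<in> V" using xy by (auto simp: V_def)
    thus ?thesis
    proof cases
      case 1
      thus ?thesis using e(2) dom xy ne fv by auto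
    next
      case 2
      thus ?thesis using e(1) dom xy ne fv by auto
    next
      case 3
      have "{x, y} \<in> edges G \<longleftrightarrow> x \<noteq> y \<and> y \<in> C x"
        using e(2) 3 nbrs_irrefl[OF G, of x] by (auto simp: C_def V_def)
      also have "\<dots> \<longleftrightarrow> x \<noteq> y \<and> C x = C y" using Ceq[OF 3(1)] Cself by blast
      also have "\<dots> \<longleftrightarrow> x \<noteq> y \<and> g (C x) = g (C y)" using Cinj[OF 3] by auto
      finally show ?thesis using fdiv[OF 3(1)] fdiv[OF 3(2)] fpos[OF 3(1)] fpos[OF 3(2)] ne by simp
    qed
  qed
  have "{{a, b} | a b. a < n \<and> b < n \<and> ?adj a b} = (\<lambda>e. f ` e) ` edges G" (is "?L = ?R")
  proof (rule Set.set_eqI, rule iffI)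
    fix e assume "e \<in> ?L"
    then obtain a b where e: "e = {a, b}" "a < n" "b < n" "?adj a b" by blast
    obtain x y where x: "x \<in> verts G" "a = f x" and y: "y \<in> verts G" "b = f y"
      using e bij by (metis atLeastLessThan_iff bij_betw_def imageE le0)
    have "{x, y} \<in> edges G" using adj x y e(4) by simp
    moreover have "e = f ` {x, y}" using e x y by simp
    ultimately show "e \<in> ?R" by blast
  next
    fix e assume "e \<in> ?R"
    then obtain e' where e': "e' \<in> edges G" "e = f ` e'" by blast
    obtain x y where xy: "e' = {x, y}" "x \<in> verts G" "y \<in> verts G"
      using edge_doubleton[OF G e'(1)] by metis
    have "?adj (f x) (f y)" using adj xy e' by simp
    moreover have "f x < n" "f y < n" using range xy by auto
    moreover have "e = {f x, f y}" using e' xy by simp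
    ultimately show "e \<in> ?L" by blast
  qed
  with bij show "graph_iso G (F_graph 2 t n)"
    unfolding graph_iso_def F_graph_def verts_def edges_def by auto
qed

text \<open>This extracts what the eigenvector of the extremal graph depends on. As \<open>t\<close>
  divides \<open>n - 1\<close>, every block is full, and a vertex of a block is adjacent to its
  \<open>t - 1\<close> companions and to vertex 0.\<close>

lemma F_graph_iso_structure:
  assumes G: "simple_graph G" and t: "t \<ge> 2" and n: "n mod t = 1"
    and iso: "graph_iso G (F_graph 2 t n)"
  obtains v where "v \<in> verts G" "nbrs G v = verts G - {v}"
    "\<And>x. x \<in> verts G - {v} \<Longrightarrow> card (nbrs G x) = t"
proof -
  obtain f where f: "bij_betw f (verts G) (verts (F_graph 2 t n))"
    and E: "edges (F_graph 2 t n) = (\<lambda>e. f ` e) ` edges G"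
    using iso unfolding graph_iso_def by blast
  have fV: "f ` verts G = {0..<n}" and inj: "inj_on f (verts G)"
    using f by (auto simp: bij_betw_def F_graph_def verts_def)
  let ?adj = "\<lambda>a b. a \<noteq> b \<and> (a = 0 \<or> b = 0 \<or> (a - 1) div t = (b - 1) div t)"
  have EF: "edges (F_graph 2 t n) = {{a, b} | a b. a < n \<and> b < n \<and> ?adj a b}"
    by (simp add: F_graph_def edges_def)
  have EF': "{a, b} \<in> edges (F_graph 2 t n) \<longleftrightarrow> ?adj a b" if "a < n" "b < n" for a b
    unfolding EF using that by (auto simp: doubleton_eq_iff)
  have adj: "x \<in> nbrs G y \<longleftrightarrow> ?adj (f x) (f y)" if xy: "x \<in> verts G" "y \<in> verts G" for x y
  proof -
    have "{f x, f y} \<in> (\<lambda>e. f ` e) ` edges G \<longleftrightarrow> {x, y} \<in> edges G"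
    proof
      assume "{f x, f y} \<in> (\<lambda>e. f ` e) ` edges G"
      then obtain e where e: "e \<in> edges G" "f ` e = f ` {x, y}" by force
      have "e \<subseteq> verts G" using e G by (auto simp: simple_graph_def)
      hence "e = {x, y}" using e(2) inj xy by (intro inj_on_image_eq_iff[OF inj, THEN iffD1]) auto
      thus "{x, y} \<in> edges G" using e by simp
    next
      assume "{x, y} \<in> edges G"
      from imageI[OF this, of "\<lambda>e. f ` e"] show "{f x, f y} \<in> (\<lambda>e. f ` e) ` edges G" by simp
    qed
    moreover have "f x < n" "f y < n" using fV xy by auto
    ultimately show ?thesis using EF'[of "f x" "f y"] E xy by (simp add: nbrs_def)
  qed
  have n': "n = 1 + t * (n div t)" using n by (metis add.commute mult_div_mod_eq)
  hence "0 \<in> f ` verts G" using fV by auto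
  then obtain v where v: "v \<in> verts G" "f v = 0" by auto
  have im: "f ` nbrs G y = {b. b < n \<and> ?adj b (f y)}" if "y \<in> verts G" for y
  proof (intro Set.set_eqI iffI)
    fix b assume "b \<in> f ` nbrs G y"
    then obtain x where x: "x \<in> nbrs G y" "b = f x" by blast
    hence "x \<in> verts G" using nbrs_subset[of G y] by blast
    with x adj[OF this that] fV show "b \<in> {b. b < n \<and> ?adj b (f y)}" by auto
  next
    fix b assume b: "b \<in> {b. b < n \<and> ?adj b (f y)}"
    then obtain x where "x \<in> verts G" "b = f x" using fV by (metis (no_types, lifting) atLeast0LessThan imageE lessThan_iff mem_Collect_eq)
    thus "b \<in> f ` nbrs G y" using b adj that by auto
  qed
  have dom: "nbrs G v = verts G - {v}"
  proof (intro Set.set_eqI iffI)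
    fix x assume "x \<in> nbrs G v"
    thus "x \<in> verts G - {v}" using nbrs_subset[of G v] nbrs_irrefl[OF G, of v] by blast
  next
    fix x assume x: "x \<in> verts G - {v}"
    hence "f x \<noteq> f v" using inj v by (metis DiffE inj_onD insertI1)
    thus "x \<in> nbrs G v" using adj v x by auto
  qed
  moreover have "card (nbrs G x) = t" if x: "x \<in> verts G - {v}" for x
  proof -
    have k: "f x \<noteq> 0" "f x < n" using x v inj fV by (metis DiffE inj_onD insertI1) (use x fV in auto)
    define q where "q = (f x - 1) div t"
    have "f x - 1 < t * (n div t)" using k n' by linarith
    hence q: "q < n div t" using t by (simp add: q_def div_less_iff_less_mult mult.commute)
    \<comment> \<open>The block of \<open>f x\<close> ends within the range of vertices, since there
      is no partial last block.\<close>
    have bound: "t * q + t \<le> t * (n div t)" using q by (metis Suc_leI mult_Suc_right add.commute mult_le_mono2)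
    have block: "b - 1 \<in> {t * q..<t * q + t} \<longleftrightarrow> (b - 1) div t = q" for b
    proof
      assume "b - 1 \<in> {t * q..<t * q + t}"
      thus "(b - 1) div t = q" by (intro div_nat_eqI) auto
    next
      assume "(b - 1) div t = q"
      thus "b - 1 \<in> {t * q..<t * q + t}"
        using t dividend_less_times_div[of t "b - 1"] times_div_less_eq_dividend[of t "b - 1"]
        by auto
    qed
    have "{b. b < n \<and> ?adj b (f x)} = insert 0 ({1 + t * q..<1 + t * q + t} - {f x})" (is "?L = ?R")
    proof (intro Set.set_eqI)
      fix b
      show "b \<in> ?L \<longleftrightarrow> b \<in> ?R"
      \<comment> \<open>At \<open>b = 0\<close> the truncated \<open>b - 1\<close> would put vertex
        0 into the first block.\<close>
      proof (cases "b = 0")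
        case True
        thus ?thesis using k by auto
      next
        case False
        have "b \<in> ?R \<longleftrightarrow> b \<noteq> f x \<and> b - 1 \<in> {t * q..<t * q + t}" using False by auto
        also have "\<dots> \<longleftrightarrow> b \<noteq> f x \<and> (b - 1) div t = q" by (simp only: block)
        finally have R: "b \<in> ?R \<longleftrightarrow> b \<noteq> f x \<and> (b - 1) div t = q" .
        have "b < n" if "b \<in> ?R" using that False bound n' by auto
        with R show ?thesis using False k by (auto simp: q_def)
      qed
    qed
    moreover have "f x - 1 \<in> {t * q..<t * q + t}" using block[of "f x"] q_def by blast
    hence "f x \<in> {1 + t * q..<1 + t * q + t}" using k(1) by auto
    ultimately have "card (f ` nbrs G x) = t" using im[of x] x t by simp
    moreover have "inj_on f (nbrs G x)" by (rule inj_on_subset[OF inj nbrs_subset])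
    ultimately show ?thesis by (simp add: card_image)
  qed
  ultimately show thesis using that v by blast
qed

section \<open>Bounding the index\<close>

lemma card_nbrs_less:
  assumes "simple_graph G" "v \<in> verts G"
  shows "card (nbrs G v) < card (verts G)"
proof -
  have "nbrs G v \<subset> verts G" using nbrs_subset[of G v] nbrs_irrefl[OF assms(1), of v] assms(2) by blast
  thus ?thesis using assms(1) by (simp add: simple_graph_def psubset_card_mono)
qed

section \<open>Graphs without a dominating vertex\<close>

text \<open>Both sides count walks of length two from \<open>v\<close>, grouped by their middle
  vertex and by their end vertex.\<close>

lemma sum_card_nbrs:
  assumes G: "simple_graph G"
  shows "(\<Sum>u\<in>nbrs G v. card (nbrs G u)) = (\<Sum>w\<in>verts G. card (nbrs G w \<inter> nbrs G v))"
proof -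
  have fin: "finite (verts G)" using G by (simp add: simple_graph_def)
  have "(\<Sum>u\<in>nbrs G v. card (nbrs G u)) = (\<Sum>u\<in>nbrs G v. \<Sum>w\<in>verts G. if {u, w} \<in> edges G then 1 else 0)"
    using fin by (intro sum.cong) (auto simp: nbrs_def insert_commute sum.If_cases Int_def)
  also have "\<dots> = (\<Sum>w\<in>verts G. \<Sum>u\<in>nbrs G v. if {u, w} \<in> edges G then 1 else 0)"
    by (rule sum.swap)
  also have "\<dots> = (\<Sum>w\<in>verts G. card (nbrs G w \<inter> nbrs G v))"
  proof (intro sum.cong refl)
    fix w
    have "nbrs G v \<inter> {u. {u, w} \<in> edges G} = nbrs G w \<inter> nbrs G v" by (auto simp: nbrs_def)
    thus "(\<Sum>u\<in>nbrs G v. if {u, w} \<in> edges G then 1 else 0) = card (nbrs G w \<inter> nbrs G v)"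
      using finite_nbrs[OF G, of v] by (simp add: sum.If_cases)
  qed
  finally show ?thesis .
qed

text \<open>With degrees as weights the bound is the largest value of \<open>d v\<close> plus the mean degree of the
  neighbours of \<open>v\<close>. Degrees from \<open>t\<close> to \<open>n - 1 - t\<close> are handled by counting paths of length two
  from \<open>v\<close>; for degrees below \<open>t\<close> two neighbours of \<open>v\<close> have at most \<open>n + t - 1\<close> as their
  degree sum, so all of them but one have degree at most half of that.\<close>

lemma Q_eigenvalue_le_of_small_degrees:
  fixes G :: "'a graph"
  assumes G: "simple_graph G" and free: "minor_free G (Kbip 2 t)" and n: "card (verts G) = n"
    and t: "t \<ge> 1" "n \<ge> t\<^sup>2 + 1" "n \<ge> 3 * t"
    and deg: "\<And>v. v \<in> verts G \<Longrightarrow> card (nbrs G v) + t + 1 \<le> n"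
    and ev: "Q_eigenvalue G \<mu>"
  shows "\<mu> \<le> real n"
proof (rule Q_eigenvalue_weight_bound[OF G ev])
  have fin: "finite (verts G)" using G by (simp add: simple_graph_def)
  fix v assume v: "v \<in> verts G"
  show "0 \<le> real (card (nbrs G v))" by simp
  show "nbrs G v = {}" if "real (card (nbrs G v)) = 0"
    using that finite_nbrs[OF G] by simp
  assume d0: "real (card (nbrs G v)) > 0"
  define d where "d = card (nbrs G v)"
  define S where "S = (\<Sum>u\<in>nbrs G v. card (nbrs G u))"
  have "d \<ge> 1" using d0 by (simp add: d_def)
  have "real d * real d + real S \<le> real n * real d"
  proof (cases "d \<ge> t")
    case True
    \<comment> \<open>The walks that return to \<open>v\<close> number \<open>d\<close>; any other
      end vertex is reached at most \<open>t - 1\<close> times.\<close>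
    have "S = d + (\<Sum>w\<in>verts G - {v}. card (nbrs G w \<inter> nbrs G v))"
      unfolding S_def sum_card_nbrs[OF G] by (subst sum.remove[OF fin v]) (simp add: d_def)
    also have "\<dots> \<le> d + (\<Sum>w\<in>verts G - {v}. t - 1)"
    proof (intro add_left_mono sum_mono)
      fix w assume "w \<in> verts G - {v}"
      thus "card (nbrs G w \<inter> nbrs G v) \<le> t - 1"
        using common_nbrs_less[OF G free, of w v] v by simp
    qed
    also have "\<dots> = d + (n - 1) * (t - 1)" using v n fin by simp
    finally have "real S \<le> real (d + (n - 1) * (t - 1))" by (rule of_nat_mono)
    also have "\<dots> = real d + (real n - 1) * (real t - 1)" using t by simp
    finally have S: "real S \<le> real d + (real n - 1) * (real t - 1)" .
    have "real d + real t + 1 \<le> real n" using deg[OF v] by (simp add: d_def)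
    \<comment> \<open>The product equals \<open>n d - d^2 - d - t (n - 1) + t^2\<close>. With
      \<open>t^2 \<le> n - 1\<close> this yields
      \<open>d^2 + d + (n - 1) (t - 1) \<le> n d\<close>.\<close>
    hence "0 \<le> (real d - real t) * (real n - 1 - real t - real d)"
      using True by (intro mult_nonneg_nonneg) auto
    moreover have "real t * real t \<le> real n - 1"
      using t(2) by (metis le_diff_eq of_nat_1 of_nat_add of_nat_le_iff of_nat_mult power2_eq_square)
    ultimately show ?thesis using S by (simp add: algebra_simps)
  next
    case False
    have finv: "finite (nbrs G v)" using finite_nbrs[OF G] .
    have ne: "nbrs G v \<noteq> {}" using \<open>d \<ge> 1\<close> by (auto simp: d_def)
    have "Max ((\<lambda>w. card (nbrs G w)) ` nbrs G v) \<in> (\<lambda>w. card (nbrs G w)) ` nbrs G v"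
      using finv ne by (intro Max_in) auto
    then obtain u where u: "u \<in> nbrs G v"
      "Max ((\<lambda>w. card (nbrs G w)) ` nbrs G v) = card (nbrs G u)" by blast
    have umax: "card (nbrs G w) \<le> card (nbrs G u)" if "w \<in> nbrs G v" for w
      unfolding u(2)[symmetric] using finv that by (intro Max_ge) auto
    have uV: "u \<in> verts G" using u nbrs_subset[of G v] by blast
    have half: "2 * card (nbrs G w) \<le> n + t - 1" if w: "w \<in> nbrs G v - {u}" for w
    proof -
      have wV: "w \<in> verts G" "w \<noteq> u" using w nbrs_subset[of G v] by blast+
      have "card (nbrs G w) + card (nbrs G u) = card (nbrs G w \<union> nbrs G u) + card (nbrs G w \<inter> nbrs G u)"
        by (intro card_Un_Int finite_nbrs[OF G])
      moreover have "card (nbrs G w \<union> nbrs G u) \<le> n"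
        unfolding n[symmetric] using nbrs_subset[of G w] nbrs_subset[of G u] by (intro card_mono fin) auto
      moreover have "card (nbrs G w \<inter> nbrs G u) < t"
        using common_nbrs_less[OF G free] wV uV by blast
      moreover have "card (nbrs G w) \<le> card (nbrs G u)" using umax w by blast
      ultimately show ?thesis by linarith
    qed
    \<comment> \<open>Only the neighbour \<open>u\<close> of largest degree is charged the general
      degree bound; the other \<open>d - 1\<close> neighbours are charged
      \<open>(n + t - 1) / 2\<close> each.\<close>
    have "2 * S = 2 * card (nbrs G u) + (\<Sum>w\<in>nbrs G v - {u}. 2 * card (nbrs G w))"
      unfolding S_def by (subst sum.remove[OF finv u(1)]) (simp add: sum_distrib_left)
    also have "\<dots> \<le> 2 * (n - 1 - t) + (\<Sum>w\<in>nbrs G v - {u}. n + t - 1)"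
      using deg[OF uV] by (intro add_mono sum_mono half) auto
    also have "\<dots> = 2 * (n - 1 - t) + (d - 1) * (n + t - 1)"
      using u(1) finv by (simp add: d_def)
    finally have "real (2 * S) \<le> real (2 * (n - 1 - t) + (d - 1) * (n + t - 1))" by (rule of_nat_mono)
    also have "\<dots> = 2 * (real n - 1 - real t) + (real d - 1) * (real n + real t - 1)"
      using \<open>d \<ge> 1\<close> t deg[OF v] by simp
    finally have S: "2 * real S \<le> 2 * (real n - 1 - real t) + (real d - 1) * (real n + real t - 1)"
      by simp
    \<comment> \<open>By the bound on \<open>S\<close>, twice the slack in the goal is at least this
      product plus \<open>2 t\<close>. The second factor is nonnegative since \<open>d < t\<close>
      and \<open>3 t \<le> n\<close>.\<close>
    have "0 \<le> (real d - 1) * (real n - (2 * real d + 1 + real t))"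
      using \<open>d \<ge> 1\<close> False t(3) by (intro mult_nonneg_nonneg) auto
    with S show ?thesis by (simp add: algebra_simps)
  qed
  thus "signless_lap_mult G (\<lambda>v. real (card (nbrs G v))) v \<le> real n * real (card (nbrs G v))"
    by (simp add: signless_lap_mult_nbrs d_def S_def)
qed simp

lemma signless_lap_mult_star_weight:
  assumes G: "simple_graph G" and v: "v \<in> verts G"
  shows "signless_lap_mult G (\<lambda>u. if u = v then X else 1) v = real (card (nbrs G v)) * (X + 1)"
    and "u \<noteq> v \<Longrightarrow> signless_lap_mult G (\<lambda>u. if u = v then X else 1) u =
           2 * real (card (nbrs G u)) + (if v \<in> nbrs G u then X - 1 else 0)"
proof -
  have "(\<Sum>u\<in>nbrs G v. if u = v then X else 1) = (\<Sum>u\<in>nbrs G v. 1)"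
    using nbrs_irrefl[OF G, of v] by (intro sum.cong) auto
  thus "signless_lap_mult G (\<lambda>u. if u = v then X else 1) v = real (card (nbrs G v)) * (X + 1)"
    by (simp add: signless_lap_mult_nbrs algebra_simps)
  assume "u \<noteq> v"
  have "(\<Sum>w\<in>nbrs G u. if w = v then X else 1) = (\<Sum>w\<in>nbrs G u. 1 + (if w = v then X - 1 else 0))"
    by (intro sum.cong) auto
  also have "\<dots> = real (card (nbrs G u)) + (if v \<in> nbrs G u then X - 1 else 0)"
    using finite_nbrs[OF G, of u] by (simp add: sum.distrib)
  finally show "signless_lap_mult G (\<lambda>u. if u = v then X else 1) u =
      2 * real (card (nbrs G u)) + (if v \<in> nbrs G u then X - 1 else 0)"
    using \<open>u \<noteq> v\<close> by (simp add: signless_lap_mult_nbrs)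
qed

text \<open>Another vertex has at most \<open>t - 1\<close> neighbours among those of
  \<open>v\<close> and at most \<open>t\<close> elsewhere. Its degree is therefore so small that its
  row tolerates a large weight at \<open>v\<close>, which in turn lowers the ratio at
  \<open>v\<close>.\<close>

lemma Q_eigenvalue_le_of_large_degree:
  fixes G :: "'a graph"
  assumes G: "simple_graph G" and free: "minor_free G (Kbip 2 t)" and n: "card (verts G) = n"
    and t: "t \<ge> 1" "n \<ge> 8 * t"
    and v: "v \<in> verts G" and d: "card (nbrs G v) + 2 \<le> n" "n \<le> card (nbrs G v) + t"
    and ev: "Q_eigenvalue G \<mu>"
  shows "\<mu> \<le> real n"
proof (rule Q_eigenvalue_weight_bound[OF G ev])
  have fin: "finite (verts G)" using G by (simp add: simple_graph_def)
  \<comment> \<open>The solution of \<open>(n - 2) (X + 1) = n X\<close>, which makes the row of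
    \<open>v\<close> exact at degree \<open>n - 2\<close>.\<close>
  define X where "X = (real n - 2) / 2"
  have X: "X \<ge> 1" using t by (simp add: X_def)
  let ?x = "\<lambda>u. if u = v then X else 1"
  fix u assume u: "u \<in> verts G"
  show "?x u \<ge> 0" using X by simp
  show "nbrs G u = {}" if "?x u = 0" using that X by (auto split: if_splits)
  show "signless_lap_mult G ?x u \<le> real n * ?x u"
  proof (cases "u = v")
    case True
    have "real (card (nbrs G v)) * (X + 1) \<le> (real n - 2) * (X + 1)"
      using d(1) X by (intro mult_right_mono) auto
    also have "\<dots> = real n * X" by (simp add: X_def field_simps)
    finally show ?thesis using True signless_lap_mult_star_weight(1)[OF G v] by simp
  next
    case False
    have "nbrs G u \<subseteq> (nbrs G u \<inter> nbrs G v) \<union> (verts G - nbrs G v)"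
      using nbrs_subset[of G u] by blast
    hence "card (nbrs G u) \<le> card ((nbrs G u \<inter> nbrs G v) \<union> (verts G - nbrs G v))"
      using fin finite_nbrs[OF G] by (intro card_mono) auto
    also have "\<dots> \<le> card (nbrs G u \<inter> nbrs G v) + card (verts G - nbrs G v)" by (rule card_Un_le)
    also have "card (verts G - nbrs G v) = n - card (nbrs G v)"
      using n finite_nbrs[OF G] nbrs_subset[of G v] by (simp add: card_Diff_subset)
    finally have "card (nbrs G u) < 2 * t"
      using common_nbrs_less[OF G free u v False] d by linarith
    hence "2 * real (card (nbrs G u)) \<le> 4 * real t - 2" by linarith
    \<comment> \<open>This is where \<open>n \<ge> 8 t\<close> enters, as \<open>X\<close> is just
      below \<open>n / 2\<close>.\<close>
    moreover have "4 * real t + X \<le> real n" using t(2) by (simp add: X_def field_simps)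
    moreover have "signless_lap_mult G ?x u \<le> 2 * real (card (nbrs G u)) + (X - 1)"
      using signless_lap_mult_star_weight(2)[OF G v False, of X] X by simp
    ultimately show ?thesis using False by simp
  qed
qed simp

section \<open>Graphs with a dominating vertex\<close>

text \<open>For \<open>t \<ge> 1\<close> this is the larger eigenvalue of the quotient matrix with
  rows \<open>(n - 1, n - 1)\<close> and \<open>(1, 2 t - 1)\<close>, which describes a dominating
  vertex together with \<open>n - 1\<close> vertices of degree \<open>t\<close>.\<close>

definition extremal_index :: "nat \<Rightarrow> nat \<Rightarrow> real" where
  "extremal_index t n =
     (real n + 2 * real t - 2 + sqrt ((real n - 2 * real t + 2)^2 + 8 * real t - 8)) / 2"

text \<open>Write \<open>b\<close> for the index. The rows of degree \<open>t\<close> force the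
  weight \<open>X = b - (2 t - 1)\<close> at the dominating vertex, and the row of that vertex then
  reads \<open>(X + 1) (n - 1) = b X\<close>.\<close>

lemma extremal_index_eq:
  assumes "t \<ge> 1"
  shows "(extremal_index t n - (2 * real t - 1) + 1) * (real n - 1)
           = extremal_index t n * (extremal_index t n - (2 * real t - 1))"
proof -
  define s where "s = sqrt ((real n - 2 * real t + 2)^2 + 8 * real t - 8)"
  have b: "extremal_index t n = (real n + 2 * real t - 2 + s) / 2"
    by (simp add: extremal_index_def s_def)
  have "s\<^sup>2 = (real n - 2 * real t + 2)^2 + 8 * real t - 8"
    unfolding s_def
  proof (rule real_sqrt_pow2)
    have "real t \<ge> 1" using assms by simp
    thus "0 \<le> (real n - 2 * real t + 2)\<^sup>2 + 8 * real t - 8"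
      using zero_le_power2[of "real n - 2 * real t + 2"] by linarith
  qed
  thus ?thesis unfolding b by (simp add: field_simps power2_eq_square)
qed

text \<open>The gap above \<open>n\<close> is strict, so a graph with index at most \<open>n\<close>
  can never attain equality.\<close>

lemma extremal_index_greater:
  assumes "t \<ge> 2"
  shows "real n < extremal_index t n"
proof -
  have "real n - 2 * real t + 2 < sqrt ((real n - 2 * real t + 2)^2 + 8 * real t - 8)"
    using assms by (intro real_less_rsqrt) simp
  thus ?thesis by (simp add: extremal_index_def)
qed

text \<open>Apart from \<open>v\<close>, all neighbours of \<open>u\<close> are common neighbours of
  \<open>u\<close> and \<open>v\<close>.\<close>

lemma dominating_vertex_degree_le:
  assumes G: "simple_graph G" and free: "minor_free G (Kbip 2 t)"
    and v: "v \<in> verts G" "nbrs G v = verts G - {v}" and u: "u \<in> verts G - {v}"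
  shows "card (nbrs G u) \<le> t"
proof -
  have "nbrs G u \<subseteq> insert v (nbrs G u \<inter> nbrs G v)" using v nbrs_subset[of G u] by blast
  hence "card (nbrs G u) \<le> card (insert v (nbrs G u \<inter> nbrs G v))"
    using finite_nbrs[OF G] by (intro card_mono) auto
  also have "\<dots> \<le> Suc (card (nbrs G u \<inter> nbrs G v))" by (rule card_insert_le_m1) auto
  finally show ?thesis using common_nbrs_less[OF G free, of u v] u v by auto
qed

text \<open>The weights are the Perron vector of the extremal graph.\<close>

lemma Q_eigenvalue_dominating_vertex:
  fixes G :: "'a graph"
  assumes G: "simple_graph G" and free: "minor_free G (Kbip 2 t)" and n: "card (verts G) = n"
    and t: "t \<ge> 2" "n \<ge> 2 * t" and v: "v \<in> verts G" "nbrs G v = verts G - {v}"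
    and ev: "Q_eigenvalue G \<mu>"
  shows "\<mu> \<le> extremal_index t n"
    and "\<mu> = extremal_index t n \<Longrightarrow> u \<in> verts G - {v} \<Longrightarrow> card (nbrs G u) = t"
proof -
  have fin: "finite (verts G)" using G by (simp add: simple_graph_def)
  define b where "b = extremal_index t n"
  define X where "X = b - (2 * real t - 1)"
  have "b > real n" using extremal_index_greater t by (simp add: b_def)
  hence X: "X > 1" using t(2) by (simp add: X_def)
  let ?x = "\<lambda>u. if u = v then X else 1 :: real"
  have dv: "real (card (nbrs G v)) = real n - 1"
    using v n fin card_nbrs_less[OF G v(1)] by simp
  have rowv: "signless_lap_mult G ?x v = b * ?x v"
    using signless_lap_mult_star_weight(1)[OF G v(1), of X] dv extremal_index_eq[of t n] t(1)
    by (simp add: X_def b_def mult.commute)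
  have rowu: "signless_lap_mult G ?x u = 2 * real (card (nbrs G u)) + X - 1"
    if "u \<in> verts G - {v}" for u
    using signless_lap_mult_star_weight(2)[OF G v(1), of u X] that v nbrs_sym[of u G v]
      nbrs_sym[of v G u] by auto
  \<comment> \<open>The slack in this row is \<open>2 (t - d)\<close> with \<open>d\<close> the
    degree of \<open>u\<close>, so the row is exact precisely at degree \<open>t\<close>.\<close>
  have rowu_le: "signless_lap_mult G ?x u \<le> b * ?x u" if "u \<in> verts G - {v}" for u
    using rowu[OF that] dominating_vertex_degree_le[OF G free v that] that by (simp add: X_def)
  have bound: "signless_lap_mult G ?x u \<le> b * ?x u" if "u \<in> verts G" for u
    using rowv rowu_le that by (cases "u = v") auto
  show "\<mu> \<le> extremal_index t n"
    unfolding b_def[symmetric]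
    by (rule Q_eigenvalue_weight_bound[OF G ev, where x = ?x])
      (use X bound \<open>b > real n\<close> in \<open>auto split: if_splits\<close>)
  assume "\<mu> = extremal_index t n" and u: "u \<in> verts G - {v}"
  hence \<mu>: "\<mu> = b" by (simp add: b_def)
  obtain y where y: "\<exists>v\<in>verts G. y v \<noteq> 0"
    "\<And>v. v \<in> verts G \<Longrightarrow> signless_lap_mult G y v = b * y v"
    using ev unfolding Q_eigenvalue_def \<mu> by blast
  have x0: "?x w \<ge> 0" and xy: "?x w = 0 \<Longrightarrow> y w = 0" for w using X by (auto split: if_splits)
  obtain m w where m: "m > 0" and w: "w \<in> verts G" "\<bar>y w\<bar> = m * ?x w"
    and le: "\<And>u. u \<in> verts G \<Longrightarrow> \<bar>y u\<bar> \<le> m * ?x u"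
    using maximal_ratio[of "verts G" y ?x, OF fin y(1) x0 xy] by blast
  have at: "b * ?x z \<le> signless_lap_mult G ?x z"
    "b * ?x z = signless_lap_mult G ?x z \<Longrightarrow> c \<in> nbrs G z \<Longrightarrow> \<bar>y c\<bar> = m * ?x c"
    if "z \<in> verts G" "\<bar>y z\<bar> = m * ?x z" for z c
    using eigenvalue_at_maximal_ratio[of G z y b m ?x, OF G that(1) y(2)[OF that(1)] m that(2) le]
    by blast+
  \<comment> \<open>A vertex attaining the ratio \<open>m\<close> has an exact row, and an exact row
    passes the ratio on to all neighbours. Thus it travels from \<open>w\<close> to the dominating
    \<open>v\<close> and on to every \<open>u\<close>.\<close>
  have tight: "b * ?x z = signless_lap_mult G ?x z" if "z \<in> verts G" "\<bar>y z\<bar> = m * ?x z" for z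
    by (rule antisym[OF at(1)[OF that] bound[OF that(1)]])
  have "\<bar>y v\<bar> = m * ?x v"
  proof (cases "w = v")
    case False
    hence "v \<in> nbrs G w" using w(1) v nbrs_sym[of v G w] by blast
    from at(2)[OF w tight[OF w] this] show ?thesis .
  qed (use w in simp)
  moreover have "u \<in> nbrs G v" using u v by blast
  ultimately have "\<bar>y u\<bar> = m * ?x u" using at(2)[OF v(1) _ tight[OF v(1)]] by blast
  from tight[OF _ this] u rowu[OF u] show "card (nbrs G u) = t"
    by (simp add: X_def)
qed

text \<open>With all other degrees equal to \<open>t\<close>, the weights \<open>X\<close> and 1
  satisfy every row exactly; a vertex besides \<open>v\<close> supplies the nonzero entry 1.\<close>

lemma Q_eigenvalue_extremal_index:
  assumes G: "simple_graph G" and n: "card (verts G) = n" and t: "t \<ge> 1"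
    and v: "v \<in> verts G" "nbrs G v = verts G - {v}"
    and reg: "\<And>u. u \<in> verts G - {v} \<Longrightarrow> card (nbrs G u) = t" and ne: "verts G - {v} \<noteq> {}"
  shows "Q_eigenvalue G (extremal_index t n)"
proof -
  have fin: "finite (verts G)" using G by (simp add: simple_graph_def)
  define b where "b = extremal_index t n"
  define X where "X = b - (2 * real t - 1)"
  let ?x = "\<lambda>u. if u = v then X else 1 :: real"
  define y where "y u = (if u \<in> verts G then ?x u else 0)" for u
  have lap: "signless_lap_mult G y u = signless_lap_mult G ?x u" if "u \<in> verts G" for u
  proof -
    have "(\<Sum>w\<in>nbrs G u. y w) = (\<Sum>w\<in>nbrs G u. ?x w)"
      using nbrs_subset[of G u] by (intro sum.cong) (auto simp: y_def)
    thus ?thesis using that by (simp add: signless_lap_mult_nbrs y_def)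
  qed
  have dv: "real (card (nbrs G v)) = real n - 1"
    using v n fin card_nbrs_less[OF G v(1)] by simp
  have "signless_lap_mult G ?x u = b * ?x u" if u: "u \<in> verts G" for u
  proof (cases "u = v")
    case True
    thus ?thesis
      using signless_lap_mult_star_weight(1)[OF G v(1), of X] dv extremal_index_eq[of t n] t
      by (simp add: X_def b_def mult.commute)
  next
    case False
    hence "v \<in> nbrs G u" using u v nbrs_sym[of v G u] by blast
    thus ?thesis
      using signless_lap_mult_star_weight(2)[OF G v(1) False, of X] reg[of u] u False
      by (simp add: X_def)
  qed
  hence "signless_lap_mult G y u = b * y u" if "u \<in> verts G" for u
    using lap[OF that] that by (simp add: y_def)
  moreover have "\<exists>u\<in>verts G. y u \<noteq> 0" using ne by (auto simp: y_def)
  ultimately show ?thesis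
    unfolding Q_eigenvalue_def b_def[symmetric] by (intro exI[of _ y]) (auto simp: y_def)
qed

text \<open>Both local bounds of \<open>closed_nbhds_equal\<close> come from \<open>v\<close>: it is
  adjacent to everything around a contracted edge, and it is an extra common neighbour of any two
  other vertices.\<close>

lemma dominating_regular_graph_iso_F:
  assumes G: "simple_graph G" and free: "minor_free G (Kbip 2 t)" and n: "card (verts G) = n"
    and t: "t \<ge> 4" and v: "v \<in> verts G" "nbrs G v = verts G - {v}"
    and reg: "\<And>u. u \<in> verts G - {v} \<Longrightarrow> card (nbrs G u) = t"
  shows "n mod t = 1" and "graph_iso G (F_graph 2 t n)"
proof -
  let ?N = "\<lambda>x. nbrs G x - {v}" and ?V = "verts G - {v}"
  have vN: "v \<in> nbrs G x" if "x \<in> ?V" for x using that v nbrs_sym[of v G x] by blast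
  have cardN: "card (?N x) = t - 1" if "x \<in> ?V" for x
    using reg[OF that] vN[OF that] finite_nbrs[OF G, of x] by simp
  have cl: "insert x (?N x) = insert y (?N y)" if "x \<in> ?V" "y \<in> ?N x" for x y
  proof (rule closed_nbhds_equal[of t ?V ?N x y, OF t])
    show "?N x \<subseteq> ?V" for x using nbrs_subset[of G x] by blast
    show "x \<in> ?N y" if "x \<in> ?V" "y \<in> ?N x" for x y using that nbrs_sym[of x G y] by blast
    show "x \<notin> ?N x" for x using nbrs_irrefl[OF G, of x] by blast
    show "finite (?N x)" for x using finite_nbrs[OF G, of x] by blast
    show "card (?N x) = t - 1" if "x \<in> ?V" for x using cardN[OF that] .
    show "card (?N x \<union> ?N y - {x, y}) < t" if "x \<in> ?V" "y \<in> ?N x" for x y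
    proof -
      have "?N x \<union> ?N y - {x, y} = (nbrs G x \<union> nbrs G y) \<inter> nbrs G v - {x, y}"
        using v(2) nbrs_subset[of G x] nbrs_subset[of G y] by blast
      thus ?thesis using nbrs_of_edge_common_less[OF G free, of x y v] that v by auto
    qed
    show "card (?N x \<inter> ?N y) < t - 1" if xy: "x \<in> ?V" "y \<in> ?V" "x \<noteq> y" for x y
    proof -
      have "nbrs G x \<inter> nbrs G y = insert v (?N x \<inter> ?N y)" using vN xy by blast
      hence "card (nbrs G x \<inter> nbrs G y) = Suc (card (?N x \<inter> ?N y))"
        using finite_nbrs[OF G, of x] by simp
      thus ?thesis using common_nbrs_less[OF G free, of x y] xy by simp
    qed
  qed (use that in blast)+
  show "n mod t = 1" "graph_iso G (F_graph 2 t n)"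
    using graph_iso_F_graph[OF G n v _ cardN cl] t by auto
qed

theorem theorem1p3:
  fixes G :: "'a graph" and t n :: nat
  assumes "simple_graph G"
    and "t \<ge> 4"
    and "card (verts G) = n"
    and "n \<ge> t^2 + 4 * t + 1"
    and "minor_free G (Kbip 2 t)"
  shows "q_index G \<le> (real n + 2 * real t - 2 + sqrt ((real n - 2 * real t + 2)^2 + 8 * real t - 8)) / 2
       \<and> (q_index G = (real n + 2 * real t - 2 + sqrt ((real n - 2 * real t + 2)^2 + 8 * real t - 8)) / 2
            \<longleftrightarrow> n mod t = 1 \<and> graph_iso G (F_graph 2 t n))"
  unfolding extremal_index_def[symmetric]
proof -
  note G = assms(1) and t = assms(2) and n = assms(3) and free = assms(5)
  have "t\<^sup>2 \<ge> 4 * t" using t by (simp add: power2_eq_square)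
  hence n8: "n \<ge> 8 * t" "n \<ge> t\<^sup>2 + 1" "n \<ge> 3 * t" "n \<ge> 2 * t" and n1: "n \<ge> 2"
    using assms(4) t by linarith+
  have ne: "verts G \<noteq> {}" using n n1 by auto
  have fin: "finite (verts G)" using G by (simp add: simple_graph_def)
  have ev: "Q_eigenvalue G (q_index G)" using Q_eigenvalue_q_index[OF G ne] .
  have less: "real n < extremal_index t n" using extremal_index_greater t by simp
  \<comment> \<open>An index above \<open>n\<close> rules out that all degrees are below
    \<open>n - t\<close>, and then that the large degree found is at most
    \<open>n - 2\<close>.\<close>
  have dominating_or: "(\<exists>v\<in>verts G. nbrs G v = verts G - {v}) \<or> q_index G \<le> real n"
  proof (rule disjCI)
    assume small: "\<not> q_index G \<le> real n"
    then obtain v where v: "v \<in> verts G" "n \<le> card (nbrs G v) + t"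
      using Q_eigenvalue_le_of_small_degrees[OF G free n _ n8(2,3) _ ev] t by force
    have "\<not> card (nbrs G v) + 2 \<le> n"
      using Q_eigenvalue_le_of_large_degree[OF G free n _ n8(1) v(1) _ v(2) ev] small t by auto
    hence "card (verts G - {v}) \<le> card (nbrs G v)" using n v(1) fin by simp
    moreover have "nbrs G v \<subseteq> verts G - {v}"
      using nbrs_subset[of G v] nbrs_irrefl[OF G, of v] by blast
    ultimately have "nbrs G v = verts G - {v}" using fin by (simp add: card_seteq)
    thus "\<exists>v\<in>verts G. nbrs G v = verts G - {v}" using v(1) by blast
  qed
  have le: "q_index G \<le> extremal_index t n"
    using dominating_or Q_eigenvalue_dominating_vertex(1)[OF G free n _ n8(4) _ _ ev] less t by force
  moreover have "q_index G = extremal_index t n \<longleftrightarrow> n mod t = 1 \<and> graph_iso G (F_graph 2 t n)"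
  proof
    assume eq: "q_index G = extremal_index t n"
    then obtain v where v: "v \<in> verts G" "nbrs G v = verts G - {v}"
      using dominating_or less by auto
    have "card (nbrs G u) = t" if "u \<in> verts G - {v}" for u
      using Q_eigenvalue_dominating_vertex(2)[OF G free n _ n8(4) v ev eq that] t by simp
    thus "n mod t = 1 \<and> graph_iso G (F_graph 2 t n)"
      using dominating_regular_graph_iso_F[OF G free n t v] by blast
  next
    assume "n mod t = 1 \<and> graph_iso G (F_graph 2 t n)"
    hence F: "n mod t = 1" "graph_iso G (F_graph 2 t n)" by blast+
    have "t \<ge> 2" using t by simp
    from F_graph_iso_structure[OF G this F]
    obtain v where v: "v \<in> verts G" "nbrs G v = verts G - {v}"
      "\<And>u. u \<in> verts G - {v} \<Longrightarrow> card (nbrs G u) = t" by blast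
    have "verts G - {v} \<noteq> {}"
    proof
      assume "verts G - {v} = {}"
      hence "card (verts G) \<le> card {v}" by (intro card_mono) auto
      thus False using n n1 by simp
    qed
    from Q_eigenvalue_extremal_index[OF G n _ v this] t
    have "Q_eigenvalue G (extremal_index t n)" by simp
    \<comment> \<open>The bound is itself an eigenvalue, hence at most the largest one.\<close>
    from Q_eigenvalue_le_q_index[OF G this] le show "q_index G = extremal_index t n" by simp
  qed
  ultimately show "q_index G \<le> extremal_index t n \<and>
      (q_index G = extremal_index t n \<longleftrightarrow> n mod t = 1 \<and> graph_iso G (F_graph 2 t n))" by blast
qed

end
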